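(* The lower box dimension of a generic compact metric space is zero, while its upper box dimension is infinite. That is, the set of $X\in\mathfrak{M}$ with $\dim_B(X)=0$ and $\dim^B(X)=\infty$ is a residual subset of the Gromov-Hausdorff space $(\mathfrak{M},d_{GH})$.
   Context: $\mathfrak{M}$ denotes the Gromov-Hausdorff space: the set of all nonempty compact metric spaces up to isometry, endowed with the Gromov-Hausdorff distance $d_{GH}(X,Y)=\inf d_H^Z(f(X),g(Y))$, where the infimum is over all metric spaces $Z$ and all isometric injections $f:X\to Z$, $g:Y\to Z$, and $d_H^Z$ is the Hausdorff distance between subsets of $Z$. The metric space $\mathfrak{M}$ is complete, hence a Baire space. A subset is rare if its closure has empty interior, meager if it is a countable union of rare sets, and residual if its complement is meager. "A generic compact metric space has property $P$" means that the set of $X\in\mathfrak{M}$ having $P$ is residual in $\mathfrak{M}$. For $X\in\mathfrak{M}$ and $\varepsilon>0$, $N(X,\varepsilon)=\min\{\mathrm{card}(F)\mid F\subset X,\ \forall x\in X\ d(x,F)\le\varepsilon\}$ is the minimum number of closed balls of radius $\varepsilon$ needed to cover $X$. The upper and lower box dimensions are $$\dim^B(X)=\limsup_{\varepsilon\to0^+}\frac{\log N(X,\varepsilon)}{-\log\varepsilon},\qquad \dim_B(X)=\liminf_{\varepsilon\to0^+}\frac{\log N(X,\varepsilon)}{-\log\varepsilon},$$ with values in $[0,\infty]$. *)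

theory Defs
  imports "HOL-Analysis.Analysis"
begin

section \<open>Isometries, Hausdorff distance and Gromov-Hausdorff distance\<close>

definition isometric_injection :: "'a metric \<Rightarrow> 'b metric \<Rightarrow> ('a \<Rightarrow> 'b) \<Rightarrow> bool" where
  "isometric_injection X Z f \<longleftrightarrow>
     f \<in> mspace X \<rightarrow> mspace Z \<and>
     (\<forall>x\<in>mspace X. \<forall>x'\<in>mspace X. mdist Z (f x) (f x') = mdist X x x')"

definition isometric :: "'a metric \<Rightarrow> 'b metric \<Rightarrow> bool" where
  "isometric X Y \<longleftrightarrow> (\<exists>f. isometric_injection X Y f \<and> f ` mspace X = mspace Y)"

definition compact_metric :: "'a metric \<Rightarrow> bool" where
  "compact_metric X \<longleftrightarrow> mspace X \<noteq> {} \<and> compact_space (mtopology_of X)"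

definition hausdorff_distance :: "'a metric \<Rightarrow> 'a set \<Rightarrow> 'a set \<Rightarrow> real" where
  "hausdorff_distance Z A B =
     max (SUP a\<in>A. INF b\<in>B. mdist Z a b) (SUP b\<in>B. INF a\<in>A. mdist Z a b)"

text \<open>The ambient space ranges over all metric spaces whose points are real numbers. Only the part
  \<open>f(X) \<union> g(Y)\<close> of an ambient space matters, which for compact \<open>X\<close>, \<open>Y\<close> has at most the cardinality
  of the continuum, so ambient spaces over other types give nothing new; see
  \<open>gh_distance_le_hausdorff\<close> below.\<close>

definition gh_distance :: "'a metric \<Rightarrow> 'b metric \<Rightarrow> real" where
  "gh_distance X Y =
     Inf {hausdorff_distance Z (f ` mspace X) (g ` mspace Y) | (Z :: real metric) f g.
            isometric_injection X Z f \<and> isometric_injection Y Z g}"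


section \<open>Box dimensions\<close>

text \<open>For finite \<open>F\<close> the condition \<open>d(x,F) \<le> \<epsilon>\<close> says that \<open>x\<close> lies in one of the closed balls of
  radius \<open>\<epsilon>\<close> centred in \<open>F\<close>. Finiteness is explicit because \<open>card\<close> is \<open>0\<close> on infinite sets;
  \<open>Inf\<close> of a nonempty set of naturals is its minimum.\<close>

definition covering_number :: "'a metric \<Rightarrow> real \<Rightarrow> nat" where
  "covering_number X \<epsilon> =
     Inf {card F | F. finite F \<and> F \<subseteq> mspace X \<and> mspace X \<subseteq> (\<Union>x\<in>F. mcball_of X x \<epsilon>)}"

definition upper_box_dim :: "'a metric \<Rightarrow> ereal" where
  "upper_box_dim X =
     Limsup (at_right 0) (\<lambda>\<epsilon>. ereal (ln (real (covering_number X \<epsilon>)) / - ln \<epsilon>))"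

definition lower_box_dim :: "'a metric \<Rightarrow> ereal" where
  "lower_box_dim X =
     Liminf (at_right 0) (\<lambda>\<epsilon>. ereal (ln (real (covering_number X \<epsilon>)) / - ln \<epsilon>))"


section \<open>Rare, meager and residual sets\<close>

definition rare :: "'a::topological_space set \<Rightarrow> bool" where
  "rare S \<longleftrightarrow> interior (closure S) = {}"

definition meager :: "'a::topological_space set \<Rightarrow> bool" where
  "meager S \<longleftrightarrow> (\<exists>\<A>. countable \<A> \<and> (\<forall>A\<in>\<A>. rare A) \<and> S = \<Union>\<A>)"

definition residual :: "'a::topological_space set \<Rightarrow> bool" where
  "residual S \<longleftrightarrow> meager (- S)"


section \<open>Basic facts on isometries\<close>

lemma isometric_injectionD:
  assumes "isometric_injection X Z f"
  shows "x \<in> mspace X \<Longrightarrow> f x \<in> mspace Z"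
    and "x \<in> mspace X \<Longrightarrow> x' \<in> mspace X \<Longrightarrow> mdist Z (f x) (f x') = mdist X x x'"
  using assms by (auto simp: isometric_injection_def)

lemma isometric_injection_inj_on: "isometric_injection X Z f \<Longrightarrow> inj_on f (mspace X)"
proof (rule inj_onI)
  fix x y
  assume f: "isometric_injection X Z f" and "x \<in> mspace X" "y \<in> mspace X" "f x = f y"
  then have "mdist X x y = mdist Z (f x) (f x)" "f x \<in> mspace Z"
    using isometric_injectionD[OF f, of x] isometric_injectionD(2)[OF f, of x y] by simp_all
  then have "mdist X x y = 0" by simp
  then show "x = y" using \<open>x \<in> mspace X\<close> \<open>y \<in> mspace X\<close> by simp
qed

lemma isometric_injection_comp:
  "isometric_injection X Y f \<Longrightarrow> isometric_injection Y Z g \<Longrightarrow> isometric_injection X Z (g \<circ> f)"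
  by (auto simp: isometric_injection_def Pi_iff)

lemma isometric_refl: "isometric X X"
  unfolding isometric_def isometric_injection_def by (rule exI[of _ id]) auto

lemma isometric_injection_inv_into:
  assumes "isometric_injection X Y f" "f ` mspace X = mspace Y"
  shows "isometric_injection Y X (inv_into (mspace X) f)"
  unfolding isometric_injection_def
proof (intro conjI ballI)
  show "inv_into (mspace X) f \<in> mspace Y \<rightarrow> mspace X"
    using assms by (auto simp: inv_into_into)
  fix y y' assume "y \<in> mspace Y" "y' \<in> mspace Y"
  then show "mdist X (inv_into (mspace X) f y) (inv_into (mspace X) f y') = mdist Y y y'"
    using isometric_injectionD(2)[OF assms(1), of "inv_into (mspace X) f y" "inv_into (mspace X) f y'"]
    by (simp add: assms(2) inv_into_into f_inv_into_f)
qed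

lemma isometric_sym: "isometric X Y \<Longrightarrow> isometric Y X"
proof -
  assume "isometric X Y"
  then obtain f where f: "isometric_injection X Y f" "f ` mspace X = mspace Y"
    by (auto simp: isometric_def)
  have "inv_into (mspace X) f ` mspace Y = mspace X"
    using inv_into_image_cancel[OF isometric_injection_inj_on[OF f(1)] order_refl] f(2) by simp
  then show ?thesis
    using isometric_injection_inv_into[OF f] by (auto simp: isometric_def)
qed

lemma isometric_trans: "isometric X Y \<Longrightarrow> isometric Y Z \<Longrightarrow> isometric X Z"
proof -
  assume "isometric X Y" "isometric Y Z"
  then obtain f g where "isometric_injection X Y f" "f ` mspace X = mspace Y"
      "isometric_injection Y Z g" "g ` mspace Y = mspace Z"
    unfolding isometric_def by blast
  then have "isometric_injection X Z (g \<circ> f) \<and> (g \<circ> f) ` mspace X = mspace Z"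
    by (simp only: isometric_injection_comp image_comp[symmetric])
  then show ?thesis unfolding isometric_def by blast
qed

lemma isometric_injection_continuous:
  assumes "isometric_injection X Y f"
  shows "continuous_map (mtopology_of X) (mtopology_of Y) f"
proof -
  interpret X: Metric_space "mspace X" "mdist X" by simp
  interpret Y: Metric_space "mspace Y" "mdist Y" by simp
  show ?thesis
    unfolding mtopology_of_def
    unfolding X.metric_continuous_map[OF Y.Metric_space_axioms]
    using assms by (auto simp: isometric_injection_def Pi_iff)
qed

lemma isometric_compact:
  assumes "isometric X Y" "compact_metric X"
  shows "compact_metric Y"
proof -
  obtain f where f: "isometric_injection X Y f" "f ` mspace X = mspace Y"
    using assms by (auto simp: isometric_def)
  have "compactin (mtopology_of Y) (f ` mspace X)"
    using assms isometric_injection_continuous[OF f(1)]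
    by (metis compact_metric_def compact_space_def image_compactin topspace_mtopology_of)
  then show ?thesis
    using f assms by (auto simp: compact_metric_def compact_space_def)
qed

lemma covering_number_isometric:
  assumes "isometric X Y"
  shows "covering_number X = covering_number Y"
proof -
  have *: "\<exists>G. card F = card G \<and> finite G \<and> G \<subseteq> mspace Y \<and> mspace Y \<subseteq> (\<Union>y\<in>G. mcball_of Y y \<epsilon>)"
    if iso: "isometric X Y" and F: "finite F" "F \<subseteq> mspace X" "mspace X \<subseteq> (\<Union>x\<in>F. mcball_of X x \<epsilon>)"
    for X :: "'x metric" and Y :: "'y metric" and F \<epsilon>
  proof -
    obtain f where f: "isometric_injection X Y f" "f ` mspace X = mspace Y"
      using iso by (auto simp: isometric_def)
    have "card F = card (f ` F)"
      using F isometric_injection_inj_on[OF f(1)] by (metis card_image inj_on_subset)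
    moreover have "mspace Y \<subseteq> (\<Union>y\<in>f ` F. mcball_of Y y \<epsilon>)"
    proof
      fix y assume "y \<in> mspace Y"
      then obtain x where x: "x \<in> mspace X" "y = f x" using f by auto
      then obtain p where "p \<in> F" "x \<in> mcball_of X p \<epsilon>" using F by auto
      then show "y \<in> (\<Union>y\<in>f ` F. mcball_of Y y \<epsilon>)"
        using x F(2) isometric_injectionD[OF f(1)] by (auto intro!: bexI[of _ p])
    qed
    ultimately show ?thesis
      using F f isometric_injectionD(1)[OF f(1)] by (intro exI[of _ "f ` F"]) auto
  qed
  show ?thesis
  proof
    fix \<epsilon>
    have "{card F | F. finite F \<and> F \<subseteq> mspace X \<and> mspace X \<subseteq> (\<Union>x\<in>F. mcball_of X x \<epsilon>)} =
          {card F | F. finite F \<and> F \<subseteq> mspace Y \<and> mspace Y \<subseteq> (\<Union>x\<in>F. mcball_of Y x \<epsilon>)}"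
    proof (rule equalityI; rule subsetI)
      fix n
      assume "n \<in> {card F | F. finite F \<and> F \<subseteq> mspace X \<and> mspace X \<subseteq> (\<Union>x\<in>F. mcball_of X x \<epsilon>)}"
      then obtain F where "n = card F" "finite F" "F \<subseteq> mspace X" "mspace X \<subseteq> (\<Union>x\<in>F. mcball_of X x \<epsilon>)"
        by blast
      moreover from *[OF assms this(2-)] obtain G where
        "card F = card G" "finite G" "G \<subseteq> mspace Y" "mspace Y \<subseteq> (\<Union>x\<in>G. mcball_of Y x \<epsilon>)"
        by blast
      ultimately show "n \<in> {card F | F. finite F \<and> F \<subseteq> mspace Y \<and> mspace Y \<subseteq> (\<Union>x\<in>F. mcball_of Y x \<epsilon>)}"
        by auto
    next
      fix n
      assume "n \<in> {card F | F. finite F \<and> F \<subseteq> mspace Y \<and> mspace Y \<subseteq> (\<Union>x\<in>F. mcball_of Y x \<epsilon>)}"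
      then obtain F where "n = card F" "finite F" "F \<subseteq> mspace Y" "mspace Y \<subseteq> (\<Union>x\<in>F. mcball_of Y x \<epsilon>)"
        by blast
      moreover from *[OF isometric_sym[OF assms] this(2-)] obtain G where
        "card F = card G" "finite G" "G \<subseteq> mspace X" "mspace X \<subseteq> (\<Union>x\<in>G. mcball_of X x \<epsilon>)"
        by blast
      ultimately show "n \<in> {card F | F. finite F \<and> F \<subseteq> mspace X \<and> mspace X \<subseteq> (\<Union>x\<in>F. mcball_of X x \<epsilon>)}"
        by auto
    qed
    then show "covering_number X \<epsilon> = covering_number Y \<epsilon>"
      by (simp add: covering_number_def)
  qed
qed

lemma gh_distance_isometric:
  assumes "isometric X X'" "isometric Y Y'"
  shows "gh_distance X Y = gh_distance X' Y'"
proof -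
  let ?S = "\<lambda>X Y. {hausdorff_distance Z (f ` mspace X) (g ` mspace Y) | (Z :: real metric) f g.
            isometric_injection X Z f \<and> isometric_injection Y Z g}"
  have *: "?S X Y \<subseteq> ?S X' Y'" if iso: "isometric X X'" "isometric Y Y'"
    for X :: "'x metric" and X' :: "'y metric" and Y :: "'z metric" and Y' :: "'w metric"
  proof
    fix t assume "t \<in> ?S X Y"
    then obtain Z :: "real metric" and f g
      where t: "t = hausdorff_distance Z (f ` mspace X) (g ` mspace Y)"
        and fg: "isometric_injection X Z f" "isometric_injection Y Z g" by blast
    obtain p q where pq: "isometric_injection X' X p" "p ` mspace X' = mspace X"
        "isometric_injection Y' Y q" "q ` mspace Y' = mspace Y"
      using isometric_sym[OF iso(1)] isometric_sym[OF iso(2)] unfolding isometric_def by blast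
    have "t = hausdorff_distance Z ((f \<circ> p) ` mspace X') ((g \<circ> q) ` mspace Y')"
      by (simp only: t image_comp[symmetric] pq)
    moreover have "isometric_injection X' Z (f \<circ> p)" "isometric_injection Y' Z (g \<circ> q)"
      using fg pq isometric_injection_comp by blast+
    ultimately show "t \<in> ?S X' Y'" by blast
  qed
  have "?S X Y = ?S X' Y'"
    using *[OF assms] *[OF isometric_sym[OF assms(1)] isometric_sym[OF assms(2)]] by (rule equalityI)
  then show ?thesis by (simp add: gh_distance_def)
qed


section \<open>Cross distances\<close>

text \<open>An ambient space of \<open>X\<close> and \<open>Y\<close> is encoded by the distances it induces between points of \<open>X\<close>
  and points of \<open>Y\<close>.\<close>

definition cross_distance :: "'a metric \<Rightarrow> 'b metric \<Rightarrow> ('a \<Rightarrow> 'b \<Rightarrow> real) \<Rightarrow> bool" where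
  "cross_distance X Y c \<longleftrightarrow>
     (\<forall>x\<in>mspace X. \<forall>y\<in>mspace Y. 0 \<le> c x y) \<and>
     (\<forall>x\<in>mspace X. \<forall>x'\<in>mspace X. \<forall>y\<in>mspace Y.
        c x y \<le> mdist X x x' + c x' y \<and> mdist X x x' \<le> c x y + c x' y) \<and>
     (\<forall>x\<in>mspace X. \<forall>y\<in>mspace Y. \<forall>y'\<in>mspace Y.
        c x y \<le> c x y' + mdist Y y' y \<and> mdist Y y y' \<le> c x y + c x y')"

definition cross_within :: "'a metric \<Rightarrow> 'b metric \<Rightarrow> ('a \<Rightarrow> 'b \<Rightarrow> real) \<Rightarrow> real \<Rightarrow> bool" where
  "cross_within X Y c r \<longleftrightarrow>
     (\<forall>x\<in>mspace X. \<exists>y\<in>mspace Y. c x y < r) \<and> (\<forall>y\<in>mspace Y. \<exists>x\<in>mspace X. c x y < r)"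

lemma cross_distanceD:
  assumes "cross_distance X Y c"
  shows "x \<in> mspace X \<Longrightarrow> y \<in> mspace Y \<Longrightarrow> 0 \<le> c x y"
    and "x \<in> mspace X \<Longrightarrow> x' \<in> mspace X \<Longrightarrow> y \<in> mspace Y \<Longrightarrow> c x y \<le> mdist X x x' + c x' y"
    and "x \<in> mspace X \<Longrightarrow> x' \<in> mspace X \<Longrightarrow> y \<in> mspace Y \<Longrightarrow> mdist X x x' \<le> c x y + c x' y"
    and "x \<in> mspace X \<Longrightarrow> y \<in> mspace Y \<Longrightarrow> y' \<in> mspace Y \<Longrightarrow> c x y \<le> c x y' + mdist Y y' y"
    and "x \<in> mspace X \<Longrightarrow> y \<in> mspace Y \<Longrightarrow> y' \<in> mspace Y \<Longrightarrow> mdist Y y y' \<le> c x y + c x y'"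
  using assms unfolding cross_distance_def by blast+

lemma cross_distance_ambient:
  assumes f: "isometric_injection X Z f" and g: "isometric_injection Y Z g"
  shows "cross_distance X Y (\<lambda>x y. mdist Z (f x) (g y))"
  unfolding cross_distance_def
proof (intro conjI ballI)
  fix x x' y assume *: "x \<in> mspace X" "x' \<in> mspace X" "y \<in> mspace Y"
  then have **: "f x \<in> mspace Z" "f x' \<in> mspace Z" "g y \<in> mspace Z"
    using isometric_injectionD(1)[OF f] isometric_injectionD(1)[OF g] by blast+
  show "mdist Z (f x) (g y) \<le> mdist X x x' + mdist Z (f x') (g y)"
    using mdist_triangle[OF **(1,2,3)] isometric_injectionD(2)[OF f *(1,2)] by simp
  show "mdist X x x' \<le> mdist Z (f x) (g y) + mdist Z (f x') (g y)"
    using mdist_triangle[OF **(1,3,2)] isometric_injectionD(2)[OF f *(1,2)]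
    by (simp add: mdist_commute)
next
  fix x y y' assume *: "x \<in> mspace X" "y \<in> mspace Y" "y' \<in> mspace Y"
  then have **: "f x \<in> mspace Z" "g y \<in> mspace Z" "g y' \<in> mspace Z"
    using isometric_injectionD(1)[OF f] isometric_injectionD(1)[OF g] by blast+
  show "mdist Z (f x) (g y) \<le> mdist Z (f x) (g y') + mdist Y y' y"
    using mdist_triangle[OF **(1,3,2)] isometric_injectionD(2)[OF g *(3,2)] by simp
  show "mdist Y y y' \<le> mdist Z (f x) (g y) + mdist Z (f x) (g y')"
    using mdist_triangle[OF **(2,1,3)] isometric_injectionD(2)[OF g *(2,3)]
    by (simp add: mdist_commute)
qed simp

lemma cross_distance_flip:
  assumes "cross_distance X Y c"
  shows "cross_distance Y X (\<lambda>y x. c x y)"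
  unfolding cross_distance_def
proof (intro conjI ballI)
  fix y y' x assume *: "y \<in> mspace Y" "y' \<in> mspace Y" "x \<in> mspace X"
  show "c x y \<le> mdist Y y y' + c x y'"
    using cross_distanceD(4)[OF assms *(3,1,2)] by (simp add: mdist_commute)
  show "mdist Y y y' \<le> c x y + c x y'"
    using cross_distanceD(5)[OF assms *(3,1,2)] .
next
  fix y x x' assume *: "y \<in> mspace Y" "x \<in> mspace X" "x' \<in> mspace X"
  show "c x y \<le> c x' y + mdist X x' x"
    using cross_distanceD(2)[OF assms *(2,3,1)] by (simp add: mdist_commute)
  show "mdist X x x' \<le> c x y + c x' y"
    using cross_distanceD(3)[OF assms *(2,3,1)] .
qed (use cross_distanceD(1)[OF assms] in blast)

lemma cross_within_flip: "cross_within X Y c r \<Longrightarrow> cross_within Y X (\<lambda>y x. c x y) r"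
  by (simp add: cross_within_def)

lemma cross_distance_add:
  assumes c: "cross_distance X Y c" and "0 \<le> \<delta>"
  shows "cross_distance X Y (\<lambda>x y. c x y + \<delta>)"
  unfolding cross_distance_def
proof (intro conjI ballI)
  fix x y assume "x \<in> mspace X" "y \<in> mspace Y"
  then show "0 \<le> c x y + \<delta>" using cross_distanceD(1)[OF c] assms(2) by force
next
  fix x x' y assume *: "x \<in> mspace X" "x' \<in> mspace X" "y \<in> mspace Y"
  show "c x y + \<delta> \<le> mdist X x x' + (c x' y + \<delta>)"
    using cross_distanceD(2)[OF c *] by simp
  show "mdist X x x' \<le> c x y + \<delta> + (c x' y + \<delta>)"
    using cross_distanceD(3)[OF c *] assms(2) by simp
next
  fix x y y' assume *: "x \<in> mspace X" "y \<in> mspace Y" "y' \<in> mspace Y"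
  show "c x y + \<delta> \<le> c x y' + \<delta> + mdist Y y' y"
    using cross_distanceD(4)[OF c *] by simp
  show "mdist Y y y' \<le> c x y + \<delta> + (c x y' + \<delta>)"
    using cross_distanceD(5)[OF c *] assms(2) by simp
qed

lemma compact_metric_lepoll_real:
  fixes X :: "'a metric"
  assumes "compact_metric X"
  shows "\<exists>h :: 'a \<Rightarrow> real. inj_on h (mspace X)"
proof -
  interpret X: Metric_space "mspace X" "mdist X" by simp
  have "X.mtotally_bounded (mspace X)"
    using assms X.compact_space_eq_mcomplete_mtotally_bounded
    by (simp add: compact_metric_def mtopology_of_def)
  then have "\<exists>K. finite K \<and> K \<subseteq> mspace X \<and> mspace X \<subseteq> (\<Union>x\<in>K. X.mball x (1 / real (Suc n)))" for n
    unfolding X.mtotally_bounded_def by simp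
  then obtain K where K: "\<And>n. finite (K n)" "\<And>n. K n \<subseteq> mspace X"
      "\<And>n. mspace X \<subseteq> (\<Union>x\<in>K n. X.mball x (1 / real (Suc n)))"
    by metis
  define D where "D = (\<Union>n. K n) \<times> (UNIV :: nat set)"
  have "countable D"
    unfolding D_def using K(1) by (intro countable_SIGMA countable_UN) (auto intro: countable_finite)
  then obtain e :: "'a \<times> nat \<Rightarrow> nat" where e: "inj_on e D"
    unfolding countable_def by blast
  define T where "T x = {(q, n). (q, n) \<in> D \<and> mdist X q x < 1 / real (Suc n)}" for x
  have "inj_on (\<lambda>x. e ` T x) (mspace X)"
  proof (rule inj_onI)
    fix x y assume xy: "x \<in> mspace X" "y \<in> mspace X" "e ` T x = e ` T y"
    then have T: "T x = T y"
      using inj_on_image_eq_iff[OF e, of "T x" "T y"] by (auto simp: T_def)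
    have "mdist X x y \<le> 2 / real (Suc n)" for n
    proof -
      obtain q where q: "q \<in> K n" "mdist X q x < 1 / real (Suc n)"
        using K(3)[of n] xy(1) by auto
      then have "(q, n) \<in> T x" by (auto simp: T_def D_def)
      then have "mdist X q y < 1 / real (Suc n)" unfolding T by (simp add: T_def)
      moreover have "mdist X x y \<le> mdist X q x + mdist X q y"
        using mdist_triangle[of x X q y] xy q K(2)[of n] by (simp add: mdist_commute subset_iff)
      ultimately have "mdist X x y < 1 / real (Suc n) + 1 / real (Suc n)"
        using q by linarith
      then show ?thesis by simp
    qed
    moreover have "(\<lambda>n. 2 / real (Suc n)) \<longlonglongrightarrow> 0"
      by (rule LIMSEQ_Suc[OF lim_const_over_n])
    ultimately have "mdist X x y \<le> 0"
      by (intro LIMSEQ_le_const[of _ 0]) auto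
    then show "x = y" using xy by (metis mdist_nonneg mdist_zero order_antisym)
  qed
  moreover obtain j :: "nat set \<Rightarrow> real" where "inj j"
    using eqpoll_imp_lepoll[OF nat_sets_eqpoll_reals] unfolding lepoll_def by blast
  ultimately have "inj_on (\<lambda>x. j (e ` T x)) (mspace X)"
    by (simp add: inj_on_def)
  then show ?thesis by blast
qed

lemma transport_metric:
  fixes X :: "'a metric" and h :: "'a \<Rightarrow> 'b"
  assumes h: "inj_on h (mspace X)"
  shows "\<exists>Y. mspace Y = h ` mspace X \<and> isometric_injection X Y h"
proof -
  let ?d = "\<lambda>u v. mdist X (inv_into (mspace X) h u) (inv_into (mspace X) h v)"
  interpret Y: Metric_space "h ` mspace X" ?d
  proof
    fix x y z
    assume "x \<in> h ` mspace X" "y \<in> h ` mspace X" "z \<in> h ` mspace X"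
    then show "?d x z \<le> ?d x y + ?d y z"
      by (intro mdist_triangle inv_into_into)
  next
    fix x y
    show "?d x y = ?d y x" by (rule mdist_commute)
    assume "x \<in> h ` mspace X" "y \<in> h ` mspace X"
    then show "?d x y = 0 \<longleftrightarrow> x = y"
      using h by auto
  qed simp
  have "isometric_injection X (metric (h ` mspace X, ?d)) h"
    using h by (auto simp: isometric_injection_def)
  then show ?thesis
    using Y.mspace_metric by blast
qed

text \<open>Every nonempty compact metric space, on whatever type, is isometric to one whose points are
  real numbers.\<close>

lemma compact_metric_isometric_real:
  fixes X :: "'a metric"
  assumes "compact_metric X"
  shows "\<exists>Y :: real metric. compact_metric Y \<and> isometric X Y"
proof -
  obtain h :: "'a \<Rightarrow> real" where "inj_on h (mspace X)"
    using compact_metric_lepoll_real[OF assms] by blast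
  then obtain Y :: "real metric" where "mspace Y = h ` mspace X" "isometric_injection X Y h"
    using transport_metric by blast
  then have "isometric X Y" by (auto simp: isometric_def)
  then show ?thesis using isometric_compact assms by blast
qed

lemma cross_distance_realize:
  fixes X :: "'a metric" and Y :: "'b metric"
  assumes X: "compact_metric X" and Y: "compact_metric Y" and c: "cross_distance X Y c"
    and pos: "\<And>x y. x \<in> mspace X \<Longrightarrow> y \<in> mspace Y \<Longrightarrow> 0 < c x y"
  shows "\<exists>(Z :: real metric) f g. isometric_injection X Z f \<and> isometric_injection Y Z g \<and>
           (\<forall>x\<in>mspace X. \<forall>y\<in>mspace Y. mdist Z (f x) (g y) = c x y)"
proof -
  let ?M = "Inl ` mspace X \<union> Inr ` mspace Y"
  define d where "d u v = (case (u, v) of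
      (Inl x, Inl x') \<Rightarrow> mdist X x x' | (Inr y, Inr y') \<Rightarrow> mdist Y y y'
    | (Inl x, Inr y) \<Rightarrow> \<bar>c x y\<bar> | (Inr y, Inl x) \<Rightarrow> \<bar>c x y\<bar>)" for u v :: "'a + 'b"
  have d_simps: "d (Inl x) (Inl x') = mdist X x x'" "d (Inr y) (Inr y') = mdist Y y y'"
    "d (Inl x) (Inr y) = \<bar>c x y\<bar>" "d (Inr y) (Inl x) = \<bar>c x y\<bar>" for x x' y y'
    by (simp_all add: d_def)
  note abs = abs_of_nonneg[OF cross_distanceD(1)[OF c]]
  interpret D: Metric_space ?M d
  proof
    fix u v
    show "0 \<le> d u v" by (cases u; cases v) (simp_all add: d_simps)
    show "d u v = d v u" by (cases u; cases v) (simp_all add: d_simps mdist_commute)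
    assume "u \<in> ?M" "v \<in> ?M"
    then show "d u v = 0 \<longleftrightarrow> u = v" using pos by (fastforce simp: d_simps)
  next
    fix u v w
    assume uvw: "u \<in> ?M" "v \<in> ?M" "w \<in> ?M"
    note tri = mdist_triangle[of _ X] mdist_triangle[of _ Y] cross_distanceD(2-5)[OF c]
      cross_distanceD(2,4)[OF cross_distance_flip[OF c]]
    show "d u w \<le> d u v + d v w"
    proof (cases u; cases v; cases w)
      fix x x' x'' assume "u = Inl x" "v = Inl x'" "w = Inl x''"
      with uvw tri show ?thesis by (auto simp: d_simps)
    next
      fix x x' y assume "u = Inl x" "v = Inl x'" "w = Inr y"
      with uvw show ?thesis using tri(3)[of x x' y] by (auto simp: d_simps abs)
    next
      fix x y x' assume "u = Inl x" "v = Inr y" "w = Inl x'"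
      with uvw show ?thesis using tri(4)[of x x' y] by (auto simp: d_simps abs)
    next
      fix x y y' assume "u = Inl x" "v = Inr y" "w = Inr y'"
      with uvw show ?thesis using tri(5)[of x y' y] by (auto simp: d_simps abs)
    next
      fix y x x' assume "u = Inr y" "v = Inl x" "w = Inl x'"
      with uvw show ?thesis using tri(3)[of x' x y] by (auto simp: d_simps abs mdist_commute)
    next
      fix y x y' assume "u = Inr y" "v = Inl x" "w = Inr y'"
      with uvw show ?thesis using tri(6)[of x y y'] by (auto simp: d_simps abs)
    next
      fix y y' x assume "u = Inr y" "v = Inr y'" "w = Inl x"
      with uvw show ?thesis using tri(5)[of x y y'] by (auto simp: d_simps abs mdist_commute)
    next
      fix y y' y'' assume "u = Inr y" "v = Inr y'" "w = Inr y''"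
      with uvw tri show ?thesis by (auto simp: d_simps)
    qed
  qed
  define Z0 where "Z0 = metric (?M, d)"
  have Z0: "mspace Z0 = ?M" "mdist Z0 = d" unfolding Z0_def by simp_all
  obtain hX :: "'a \<Rightarrow> real" and hY :: "'b \<Rightarrow> real"
    where hX: "inj_on hX (mspace X)" and hY: "inj_on hY (mspace Y)"
    using compact_metric_lepoll_real[OF X] compact_metric_lepoll_real[OF Y] by blast
  define h :: "'a + 'b \<Rightarrow> real"
    where "h = case_sum (\<lambda>x. exp (hX x)) (\<lambda>y. - exp (hY y))"
  have ne: "exp a \<noteq> - exp b" for a b :: real
    using exp_gt_zero[of a] exp_gt_zero[of b] by linarith
  have "inj_on h ?M"
  proof (rule inj_onI)
    fix u v assume uv: "u \<in> ?M" "v \<in> ?M" "h u = h v"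
    show "u = v"
    proof (cases u; cases v)
      fix x x' assume "u = Inl x" "v = Inl x'"
      with uv inj_onD[OF hX, of x x'] show ?thesis by (auto simp: h_def)
    next
      fix x y assume "u = Inl x" "v = Inr y"
      with uv ne show ?thesis by (simp add: h_def)
    next
      fix x y assume "u = Inr y" "v = Inl x"
      with uv ne[of "hX x" "hY y"] show ?thesis by (simp add: h_def)
    next
      fix y y' assume "u = Inr y" "v = Inr y'"
      with uv inj_onD[OF hY, of y y'] show ?thesis by (auto simp: h_def)
    qed
  qed
  then obtain Z where Z: "isometric_injection Z0 Z h"
    using transport_metric[of h Z0] Z0 by auto
  have l: "isometric_injection X Z0 Inl" "isometric_injection Y Z0 Inr"
    by (auto simp: isometric_injection_def Z0 d_simps)
  have "mdist Z ((h \<circ> Inl) x) ((h \<circ> Inr) y) = c x y" if "x \<in> mspace X" "y \<in> mspace Y" for x y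
    using isometric_injectionD(2)[OF Z, of "Inl x" "Inr y"] that by (simp add: Z0 d_simps abs)
  moreover have "isometric_injection X Z (h \<circ> Inl)" "isometric_injection Y Z (h \<circ> Inr)"
    using l Z isometric_injection_comp by blast+
  ultimately show ?thesis by blast
qed


section \<open>The Gromov-Hausdorff distance is a distance on isometry classes\<close>

lemma compact_metric_bounded:
  assumes "compact_metric X"
  shows "\<exists>K. \<forall>x\<in>mspace X. \<forall>x'\<in>mspace X. mdist X x x' \<le> K"
proof -
  interpret X: Metric_space "mspace X" "mdist X" by simp
  have "X.mtotally_bounded (mspace X)"
    using assms X.compact_space_eq_mcomplete_mtotally_bounded
    by (simp add: compact_metric_def mtopology_of_def)
  then have "X.mbounded (mspace X)"
    by (rule X.mtotally_bounded_imp_mbounded)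
  then show ?thesis by (simp add: X.mbounded_alt)
qed

lemma bdd_below_mdist: "bdd_below ((\<lambda>b. mdist Z a (h b)) ` B)" "bdd_below ((\<lambda>b. mdist Z (h b) a) ` B)"
  by (auto intro!: bdd_belowI[of _ 0])

lemma hausdorff_distance_le:
  assumes "A \<noteq> {}" "B \<noteq> {}"
    and "\<And>a. a \<in> A \<Longrightarrow> \<exists>b\<in>B. mdist Z a b \<le> r"
    and "\<And>b. b \<in> B \<Longrightarrow> \<exists>a\<in>A. mdist Z a b \<le> r"
  shows "hausdorff_distance Z A B \<le> r"
proof -
  have "(SUP a\<in>A. INF b\<in>B. mdist Z a b) \<le> r"
  proof (rule cSUP_least[OF assms(1)])
    fix a assume "a \<in> A"
    then obtain b where "b \<in> B" "mdist Z a b \<le> r" using assms(3) by blast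
    then show "(INF b\<in>B. mdist Z a b) \<le> r"
      by (intro cINF_lower2[OF bdd_below_mdist(1)[of Z a "\<lambda>b. b"]])
  qed
  moreover have "(SUP b\<in>B. INF a\<in>A. mdist Z a b) \<le> r"
  proof (rule cSUP_least[OF assms(2)])
    fix b assume "b \<in> B"
    then obtain a where "a \<in> A" "mdist Z a b \<le> r" using assms(4) by blast
    then show "(INF a\<in>A. mdist Z a b) \<le> r"
      by (intro cINF_lower2[OF bdd_below_mdist(2)[of Z "\<lambda>a. a" b]])
  qed
  ultimately show ?thesis by (simp add: hausdorff_distance_def)
qed

lemma SUP_INF_less:
  fixes d :: "'a \<Rightarrow> 'b \<Rightarrow> real"
  assumes "(SUP a\<in>A. INF b\<in>B. d a b) < r" "B \<noteq> {}" "a \<in> A"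
    and nonneg: "\<And>a b. 0 \<le> d a b" and K: "\<And>a b. a \<in> A \<Longrightarrow> b \<in> B \<Longrightarrow> d a b \<le> K"
  shows "\<exists>b\<in>B. d a b < r"
proof -
  have bb: "bdd_below (d a ` B)" for a
    using nonneg by (auto intro!: bdd_belowI[of _ 0])
  have "bdd_above ((\<lambda>a. INF b\<in>B. d a b) ` A)"
  proof (rule bdd_aboveI2)
    fix a assume "a \<in> A"
    obtain b where "b \<in> B" using assms(2) by blast
    then show "(INF b\<in>B. d a b) \<le> K"
      using K[OF \<open>a \<in> A\<close>] by (intro cINF_lower2[OF bb])
  qed
  then have "(INF b\<in>B. d a b) \<le> (SUP a\<in>A. INF b\<in>B. d a b)"
    using assms(3) by (intro cSUP_upper)
  then have "(INF b\<in>B. d a b) < r" using assms(1) by linarith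
  then show ?thesis
    using cINF_less_iff[OF assms(2) bb] by blast
qed

lemma hausdorff_distance_less:
  assumes "hausdorff_distance Z A B < r" "A \<noteq> {}" "B \<noteq> {}"
    and K: "\<And>a b. a \<in> A \<Longrightarrow> b \<in> B \<Longrightarrow> mdist Z a b \<le> K"
  shows "a \<in> A \<Longrightarrow> \<exists>b\<in>B. mdist Z a b < r" "b \<in> B \<Longrightarrow> \<exists>a\<in>A. mdist Z a b < r"
proof -
  have *: "(SUP a\<in>A. INF b\<in>B. mdist Z a b) < r" "(SUP b\<in>B. INF a\<in>A. mdist Z a b) < r"
    using assms(1) by (auto simp: hausdorff_distance_def)
  show "a \<in> A \<Longrightarrow> \<exists>b\<in>B. mdist Z a b < r"
    using SUP_INF_less[OF *(1) assms(3), of a K] K by simp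
  show "b \<in> B \<Longrightarrow> \<exists>a\<in>A. mdist Z a b < r"
    using SUP_INF_less[OF *(2) assms(2), of b K] K by simp
qed

lemma cross_distance_bounded:
  assumes X: "compact_metric X" and Y: "compact_metric Y" and c: "cross_distance X Y c"
  shows "\<exists>K. \<forall>x\<in>mspace X. \<forall>y\<in>mspace Y. c x y \<le> K"
proof -
  obtain x0 y0 where x0: "x0 \<in> mspace X" and y0: "y0 \<in> mspace Y"
    using X Y by (auto simp: compact_metric_def)
  obtain K where K: "\<forall>x\<in>mspace X. \<forall>x'\<in>mspace X. mdist X x x' \<le> K"
    using compact_metric_bounded[OF X] by blast
  obtain L where L: "\<forall>y\<in>mspace Y. \<forall>y'\<in>mspace Y. mdist Y y y' \<le> L"
    using compact_metric_bounded[OF Y] by blast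
  have "c x y \<le> K + c x0 y0 + L" if xy: "x \<in> mspace X" "y \<in> mspace Y" for x y
    using cross_distanceD(2)[OF c xy(1) x0 xy(2)] cross_distanceD(4)[OF c x0 xy(2) y0]
      K L xy x0 y0 by fastforce
  then show ?thesis by blast
qed

lemma hausdorff_less_cross_within:
  assumes X: "compact_metric X" and Y: "compact_metric Y"
    and f: "isometric_injection X Z f" and g: "isometric_injection Y Z g"
    and r: "hausdorff_distance Z (f ` mspace X) (g ` mspace Y) < r"
  shows "cross_within X Y (\<lambda>x y. mdist Z (f x) (g y)) r"
proof -
  obtain K where K: "\<forall>x\<in>mspace X. \<forall>y\<in>mspace Y. mdist Z (f x) (g y) \<le> K"
    using cross_distance_bounded[OF X Y cross_distance_ambient[OF f g]] by blast
  have ne: "f ` mspace X \<noteq> {}" "g ` mspace Y \<noteq> {}"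
    using X Y by (auto simp: compact_metric_def)
  have K': "mdist Z a b \<le> K" if "a \<in> f ` mspace X" "b \<in> g ` mspace Y" for a b
    using K that by blast
  show ?thesis
    using hausdorff_distance_less[OF r ne K'] by (auto simp: cross_within_def)
qed

lemma hausdorff_distance_nonneg:
  assumes X: "compact_metric X" and Y: "compact_metric Y"
    and f: "isometric_injection X Z f" and g: "isometric_injection Y Z g"
  shows "0 \<le> hausdorff_distance Z (f ` mspace X) (g ` mspace Y)"
proof (rule ccontr)
  assume "\<not> ?thesis"
  then have "cross_within X Y (\<lambda>x y. mdist Z (f x) (g y)) 0"
    using hausdorff_less_cross_within[OF assms] by simp
  moreover obtain x where "x \<in> mspace X" using X by (auto simp: compact_metric_def)
  ultimately obtain y where "mdist Z (f x) (g y) < 0" by (auto simp: cross_within_def)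
  then show False using mdist_nonneg[of Z "f x" "g y"] by linarith
qed

lemma gh_distance_bdd_below:
  assumes "compact_metric X" "compact_metric Y"
  shows "bdd_below {hausdorff_distance Z (f ` mspace X) (g ` mspace Y) | (Z :: real metric) f g.
            isometric_injection X Z f \<and> isometric_injection Y Z g}"
  using hausdorff_distance_nonneg[OF assms] by (intro bdd_belowI[of _ 0]) blast

lemma cross_distance_exists:
  assumes X: "compact_metric X" and Y: "compact_metric Y"
  shows "\<exists>c. cross_distance X Y c"
proof -
  obtain x0 y0 where x0: "x0 \<in> mspace X" and y0: "y0 \<in> mspace Y"
    using X Y by (auto simp: compact_metric_def)
  have "cross_distance X Y (\<lambda>x y. mdist X x x0 + mdist Y y y0)"
    unfolding cross_distance_def
  proof (intro conjI ballI)
    fix x x' y assume *: "x \<in> mspace X" "x' \<in> mspace X" "y \<in> mspace Y"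
    show "mdist X x x0 + mdist Y y y0 \<le> mdist X x x' + (mdist X x' x0 + mdist Y y y0)"
      using mdist_triangle[OF *(1,2) x0] by simp
    show "mdist X x x' \<le> mdist X x x0 + mdist Y y y0 + (mdist X x' x0 + mdist Y y y0)"
      using mdist_triangle[OF *(1) x0 *(2)] mdist_nonneg[of Y y y0]
      unfolding mdist_commute[of X x0 x'] by linarith
  next
    fix x y y' assume *: "x \<in> mspace X" "y \<in> mspace Y" "y' \<in> mspace Y"
    show "mdist X x x0 + mdist Y y y0 \<le> mdist X x x0 + mdist Y y' y0 + mdist Y y' y"
      using mdist_triangle[OF *(2,3) y0] by (simp add: mdist_commute)
    show "mdist Y y y' \<le> mdist X x x0 + mdist Y y y0 + (mdist X x x0 + mdist Y y' y0)"
      using mdist_triangle[OF *(2) y0 *(3)] mdist_nonneg[of X x x0]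
      unfolding mdist_commute[of Y y0 y'] by linarith
  qed simp
  then show ?thesis by blast
qed

lemma gh_distance_le_cross:
  assumes X: "compact_metric X" and Y: "compact_metric Y"
    and c: "cross_distance X Y c" and r: "cross_within X Y c r"
  shows "gh_distance X Y \<le> r"
proof (rule field_le_epsilon)
  fix \<delta> :: real assume "0 < \<delta>"
  have "\<And>x y. x \<in> mspace X \<Longrightarrow> y \<in> mspace Y \<Longrightarrow> 0 < c x y + \<delta>"
    using cross_distanceD(1)[OF c] \<open>0 < \<delta>\<close> by force
  then obtain Z :: "real metric" and f g where
    Z: "isometric_injection X Z f" "isometric_injection Y Z g"
       "\<forall>x\<in>mspace X. \<forall>y\<in>mspace Y. mdist Z (f x) (g y) = c x y + \<delta>"
    using cross_distance_realize[OF X Y cross_distance_add[OF c less_imp_le[OF \<open>0 < \<delta>\<close>]]] by blast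
  have "gh_distance X Y \<le> hausdorff_distance Z (f ` mspace X) (g ` mspace Y)"
    unfolding gh_distance_def using Z by (intro cInf_lower gh_distance_bdd_below X Y) blast
  also have "\<dots> \<le> r + \<delta>"
  proof (rule hausdorff_distance_le)
    show "f ` mspace X \<noteq> {}" "g ` mspace Y \<noteq> {}"
      using X Y by (auto simp: compact_metric_def)
    fix a assume "a \<in> f ` mspace X"
    then obtain x where x: "x \<in> mspace X" "a = f x" by blast
    then obtain y where y: "y \<in> mspace Y" "c x y < r" using r by (auto simp: cross_within_def)
    then have "mdist Z a (g y) \<le> r + \<delta>" using Z(3) x by simp
    then show "\<exists>b\<in>g ` mspace Y. mdist Z a b \<le> r + \<delta>" using y by blast
  next
    fix b assume "b \<in> g ` mspace Y"
    then obtain y where y: "y \<in> mspace Y" "b = g y" by blast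
    then obtain x where x: "x \<in> mspace X" "c x y < r" using r by (auto simp: cross_within_def)
    then have "mdist Z (f x) b \<le> r + \<delta>" using Z(3) y by simp
    then show "\<exists>a\<in>f ` mspace X. mdist Z a b \<le> r + \<delta>" using x by blast
  qed
  finally show "gh_distance X Y \<le> r + \<delta>" .
qed

lemma gh_distance_less_cross:
  assumes X: "compact_metric X" and Y: "compact_metric Y" and r: "gh_distance X Y < r"
  shows "\<exists>c. cross_distance X Y c \<and> cross_within X Y c r"
proof -
  let ?S = "{hausdorff_distance Z (f ` mspace X) (g ` mspace Y) | (Z :: real metric) f g.
            isometric_injection X Z f \<and> isometric_injection Y Z g}"
  obtain c where c: "cross_distance X Y c"
    using cross_distance_exists[OF X Y] by blast
  have "\<And>x y. x \<in> mspace X \<Longrightarrow> y \<in> mspace Y \<Longrightarrow> 0 < c x y + 1"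
    using cross_distanceD(1)[OF c] by force
  then obtain Z :: "real metric" and f g where
    "isometric_injection X Z f" "isometric_injection Y Z g"
    using cross_distance_realize[OF X Y cross_distance_add[OF c zero_le_one]] by blast
  then have "?S \<noteq> {}" by blast
  then obtain t where "t \<in> ?S" "t < r"
    using r cInf_less_iff[OF _ gh_distance_bdd_below[OF X Y]] unfolding gh_distance_def by blast
  then obtain Z :: "real metric" and f g where Z: "isometric_injection X Z f" "isometric_injection Y Z g"
      and h: "hausdorff_distance Z (f ` mspace X) (g ` mspace Y) < r" by blast
  show ?thesis
    using cross_distance_ambient[OF Z] hausdorff_less_cross_within[OF X Y Z h] by blast
qed

text \<open>Ambient spaces over an arbitrary type do not yield smaller values.\<close>

lemma gh_distance_le_hausdorff:
  fixes X :: "'a metric" and Y :: "'b metric" and Z :: "'c metric"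
  assumes X: "compact_metric X" and Y: "compact_metric Y"
    and f: "isometric_injection X Z f" and g: "isometric_injection Y Z g"
  shows "gh_distance X Y \<le> hausdorff_distance Z (f ` mspace X) (g ` mspace Y)"
proof (rule field_le_epsilon)
  fix \<delta> :: real assume "0 < \<delta>"
  then show "gh_distance X Y \<le> hausdorff_distance Z (f ` mspace X) (g ` mspace Y) + \<delta>"
    by (intro gh_distance_le_cross[OF X Y cross_distance_ambient[OF f g]]
        hausdorff_less_cross_within[OF X Y f g]) simp
qed

lemma gh_distance_nonneg:
  assumes X: "compact_metric X" and Y: "compact_metric Y"
  shows "0 \<le> gh_distance X Y"
proof (rule ccontr)
  assume "\<not> ?thesis"
  then obtain c where c: "cross_distance X Y c" "cross_within X Y c 0"
    using gh_distance_less_cross[OF X Y, of 0] by auto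
  obtain x where "x \<in> mspace X" using X by (auto simp: compact_metric_def)
  then show False
    using c cross_distanceD(1)[OF c(1)] by (fastforce simp: cross_within_def)
qed

lemma gh_distance_commute:
  assumes X: "compact_metric X" and Y: "compact_metric Y"
  shows "gh_distance X Y = gh_distance Y X"
proof -
  have *: "gh_distance Y X \<le> gh_distance X Y" if X: "compact_metric X" and Y: "compact_metric Y"
    for X :: "'x metric" and Y :: "'y metric"
  proof (rule field_le_epsilon)
    fix \<delta> :: real assume "0 < \<delta>"
    then obtain c where "cross_distance X Y c" "cross_within X Y c (gh_distance X Y + \<delta>)"
      using gh_distance_less_cross[OF X Y, of "gh_distance X Y + \<delta>"] by auto
    then show "gh_distance Y X \<le> gh_distance X Y + \<delta>"
      by (intro gh_distance_le_cross[OF Y X cross_distance_flip cross_within_flip])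
  qed
  show ?thesis using *[OF X Y] *[OF Y X] by (rule antisym[rotated])
qed

lemma gh_distance_triangle:
  assumes X: "compact_metric X" and Y: "compact_metric Y" and W: "compact_metric W"
  shows "gh_distance X W \<le> gh_distance X Y + gh_distance Y W"
proof (rule field_le_epsilon)
  fix \<delta> :: real assume "0 < \<delta>"
  obtain c where c: "cross_distance X Y c" "cross_within X Y c (gh_distance X Y + \<delta>/2)"
    using gh_distance_less_cross[OF X Y, of "gh_distance X Y + \<delta>/2"] \<open>0 < \<delta>\<close> by auto
  obtain e where e: "cross_distance Y W e" "cross_within Y W e (gh_distance Y W + \<delta>/2)"
    using gh_distance_less_cross[OF Y W, of "gh_distance Y W + \<delta>/2"] \<open>0 < \<delta>\<close> by auto
  note c0 = cross_distanceD[OF c(1)] and e0 = cross_distanceD[OF e(1)]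
  have neY: "mspace Y \<noteq> {}" using Y by (auto simp: compact_metric_def)
  define k where "k x w = (INF y\<in>mspace Y. c x y + e y w)" for x w
  have low: "k x w \<le> c x y + e y w" if "x \<in> mspace X" "y \<in> mspace Y" "w \<in> mspace W" for x y w
    unfolding k_def using that c0(1) e0(1)
    by (intro cINF_lower bdd_belowI2[of _ 0]) (simp_all add: add_nonneg_nonneg)
  have great: "t \<le> k x w" if "\<And>y. y \<in> mspace Y \<Longrightarrow> t \<le> c x y + e y w" for t x w
    unfolding k_def using neY that by (rule cINF_greatest)
  have sum: "t \<le> k x w + k x' w'"
    if "\<And>y y'. y \<in> mspace Y \<Longrightarrow> y' \<in> mspace Y \<Longrightarrow> t \<le> c x y + e y w + (c x' y' + e y' w')" for t x w x' w'
  proof -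
    have "t - k x' w' \<le> k x w"
    proof (rule great)
      fix y assume y: "y \<in> mspace Y"
      have "t - (c x y + e y w) \<le> k x' w'"
        using that[OF y] by (intro great) (simp add: algebra_simps)
      then show "t - k x' w' \<le> c x y + e y w" by simp
    qed
    then show ?thesis by simp
  qed
  have "cross_distance X W k"
    unfolding cross_distance_def
  proof (intro conjI ballI)
    fix x w assume "x \<in> mspace X" "w \<in> mspace W"
    then show "0 \<le> k x w" using c0(1) e0(1) by (intro great add_nonneg_nonneg)
  next
    fix x x' w assume *: "x \<in> mspace X" "x' \<in> mspace X" "w \<in> mspace W"
    have "k x w - mdist X x x' \<le> k x' w"
    proof (rule great)
      fix y assume y: "y \<in> mspace Y"
      show "k x w - mdist X x x' \<le> c x' y + e y w"
        using low[OF *(1) y *(3)] c0(2)[OF *(1,2) y] by simp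
    qed
    then show "k x w \<le> mdist X x x' + k x' w" by simp
    show "mdist X x x' \<le> k x w + k x' w"
    proof (rule sum)
      fix y y' assume y: "y \<in> mspace Y" "y' \<in> mspace Y"
      show "mdist X x x' \<le> c x y + e y w + (c x' y' + e y' w)"
        using c0(3)[OF *(1,2) y(1)] c0(4)[OF *(2) y(1,2)] e0(3)[OF y(1,2) *(3)]
        by (simp add: mdist_commute[of Y y' y])
    qed
  next
    fix x w w' assume *: "x \<in> mspace X" "w \<in> mspace W" "w' \<in> mspace W"
    have "k x w - mdist W w' w \<le> k x w'"
    proof (rule great)
      fix y assume y: "y \<in> mspace Y"
      show "k x w - mdist W w' w \<le> c x y + e y w'"
        using low[OF *(1) y *(2)] e0(4)[OF y *(2,3)] by simp
    qed
    then show "k x w \<le> k x w' + mdist W w' w" by simp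
    show "mdist W w w' \<le> k x w + k x w'"
    proof (rule sum)
      fix y y' assume y: "y \<in> mspace Y" "y' \<in> mspace Y"
      show "mdist W w w' \<le> c x y + e y w + (c x y' + e y' w')"
        using e0(5)[OF y(1) *(2,3)] e0(2)[OF y(1,2) *(3)] c0(5)[OF *(1) y] by simp
    qed
  qed
  moreover have "cross_within X W k (gh_distance X Y + gh_distance Y W + \<delta>)"
    unfolding cross_within_def
  proof (intro conjI ballI)
    fix x assume x: "x \<in> mspace X"
    obtain y where y: "y \<in> mspace Y" "c x y < gh_distance X Y + \<delta>/2"
      using c(2) x by (auto simp: cross_within_def)
    obtain w where w: "w \<in> mspace W" "e y w < gh_distance Y W + \<delta>/2"
      using e(2) y by (auto simp: cross_within_def)
    have "k x w < gh_distance X Y + gh_distance Y W + \<delta>"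
      using low[OF x y(1) w(1)] y w by linarith
    then show "\<exists>w\<in>mspace W. k x w < gh_distance X Y + gh_distance Y W + \<delta>" using w by blast
  next
    fix w assume w: "w \<in> mspace W"
    obtain y where y: "y \<in> mspace Y" "e y w < gh_distance Y W + \<delta>/2"
      using e(2) w by (auto simp: cross_within_def)
    obtain x where x: "x \<in> mspace X" "c x y < gh_distance X Y + \<delta>/2"
      using c(2) y by (auto simp: cross_within_def)
    have "k x w < gh_distance X Y + gh_distance Y W + \<delta>"
      using low[OF x(1) y(1) w] y x by linarith
    then show "\<exists>x\<in>mspace X. k x w < gh_distance X Y + gh_distance Y W + \<delta>" using x by blast
  qed
  ultimately show "gh_distance X W \<le> gh_distance X Y + gh_distance Y W + \<delta>"
    by (rule gh_distance_le_cross[OF X W])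
qed

lemma mdist_self: "x \<in> mspace X \<Longrightarrow> mdist X x x = 0"
  by simp

lemma gh_distance_refl:
  assumes X: "compact_metric X"
  shows "gh_distance X X = 0"
proof (rule antisym)
  show "0 \<le> gh_distance X X" by (rule gh_distance_nonneg[OF X X])
  have id: "isometric_injection X X id" by (simp add: isometric_injection_def)
  have "hausdorff_distance X (id ` mspace X) (id ` mspace X) \<le> 0"
  proof (rule hausdorff_distance_le)
    show "\<exists>b\<in>id ` mspace X. mdist X a b \<le> 0" if "a \<in> id ` mspace X" for a
      using that by (intro bexI[of _ a]) (simp_all add: mdist_self)
    show "\<exists>a\<in>id ` mspace X. mdist X a b \<le> 0" if "b \<in> id ` mspace X" for b
      using that by (intro bexI[of _ b]) (simp_all add: mdist_self)
  qed (use X in \<open>auto simp: compact_metric_def\<close>)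
  then show "gh_distance X X \<le> 0"
    using gh_distance_le_hausdorff[OF X X id id] by linarith
qed

lemma isometric_self_injection_surj:
  assumes X: "compact_metric X" and h: "isometric_injection X X h"
  shows "h ` mspace X = mspace X"
proof (rule ccontr)
  interpret X: Metric_space "mspace X" "mdist X" by simp
  have cpt: "compact_space X.mtopology"
    using X by (simp add: compact_metric_def mtopology_of_def)
  assume "\<not> ?thesis"
  then obtain p where p: "p \<in> mspace X" "p \<notin> h ` mspace X"
    using isometric_injectionD(1)[OF h] by blast
  have "compactin X.mtopology (h ` mspace X)"
    using image_compactin[OF _ isometric_injection_continuous[OF h], of "mspace X"] cpt
    by (simp add: compact_space_def mtopology_of_def)
  then have "closedin X.mtopology (h ` mspace X)"
    by (rule compactin_imp_closedin[OF X.Hausdorff_space_mtopology])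
  then obtain r where r: "0 < r" "disjnt (h ` mspace X) (X.mball p r)"
    using p unfolding X.closedin_metric by blast
  have far: "r \<le> mdist X p (h x)" if "x \<in> mspace X" for x
    using r(2) that p isometric_injectionD(1)[OF h that] by (force simp: disjnt_iff)
  define s where "s n = (h ^^ n) p" for n :: nat
  have s: "s n \<in> mspace X" for n
    by (induction n) (use p isometric_injectionD(1)[OF h] in \<open>auto simp: s_def\<close>)
  have shift: "mdist X (s (m + a)) (s (m + b)) = mdist X (s a) (s b)" for m a b
  proof (induction m)
    case (Suc m)
    then show ?case
      using isometric_injectionD(2)[OF h s s, of "m + a" "m + b"] by (simp add: s_def)
  qed simp
  have sep: "r \<le> mdist X (s m) (s n)" if "m < n" for m n
  proof -
    obtain k where "n = m + Suc k" using less_imp_Suc_add[OF \<open>m < n\<close>] by auto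
    then show ?thesis
      using shift[of m 0 "Suc k"] far[OF s[of k]] by (simp add: s_def)
  qed
  obtain l \<phi> where "strict_mono \<phi>" and lim: "limitin X.mtopology (s \<circ> \<phi>) l sequentially"
    using cpt s unfolding X.compact_space_sequentially by (metis image_subset_iff)
  then have "X.MCauchy (s \<circ> \<phi>)"
    using X.convergent_imp_MCauchy s by (metis comp_apply image_subset_iff)
  then obtain N where "\<forall>n n'. N \<le> n \<longrightarrow> N \<le> n' \<longrightarrow> mdist X (s (\<phi> n)) (s (\<phi> n')) < r"
    using r(1) unfolding X.MCauchy_def by auto
  then have "mdist X (s (\<phi> N)) (s (\<phi> (Suc N))) < r" by simp
  then show False
    using sep[OF strict_monoD[OF \<open>strict_mono \<phi>\<close>, of N "Suc N"]] by simp
qed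

lemma gh_distance_zero_injection:
  assumes X: "compact_metric X" and Y: "compact_metric Y" and 0: "gh_distance X Y = 0"
  shows "\<exists>f. isometric_injection X Y f"
proof -
  let ?P = "product_topology (\<lambda>_. mtopology_of Y) (mspace X)"
  define K where "K n = {f \<in> mspace X \<rightarrow>\<^sub>E mspace Y. \<forall>x\<in>mspace X. \<forall>x'\<in>mspace X.
      \<bar>mdist Y (f x) (f x') - mdist X x x'\<bar> \<le> 2 / real (Suc n)}" for n
  have "K n \<noteq> {}" for n
  proof -
    obtain c where c: "cross_distance X Y c" "cross_within X Y c (1 / real (Suc n))"
      using gh_distance_less_cross[OF X Y, of "1 / real (Suc n)"] 0 by auto
    obtain f where f: "\<And>x. x \<in> mspace X \<Longrightarrow> f x \<in> mspace Y \<and> c x (f x) < 1 / real (Suc n)"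
      using c(2) unfolding cross_within_def by metis
    have "\<bar>mdist Y (f x) (f x') - mdist X x x'\<bar> \<le> 2 / real (Suc n)"
      if x: "x \<in> mspace X" "x' \<in> mspace X" for x x'
    proof -
      have fx: "f x \<in> mspace Y" "f x' \<in> mspace Y"
          "c x (f x) < 1 / real (Suc n)" "c x' (f x') < 1 / real (Suc n)"
        using f x by blast+
      have "mdist Y (f x) (f x') \<le> c x (f x) + c x (f x')" "c x (f x') \<le> mdist X x x' + c x' (f x')"
        "mdist X x x' \<le> c x (f x) + c x' (f x)" "c x' (f x) \<le> c x' (f x') + mdist Y (f x) (f x')"
        using cross_distanceD(5)[OF c(1) x(1) fx(1,2)] cross_distanceD(2)[OF c(1) x fx(2)]
          cross_distanceD(3)[OF c(1) x fx(1)] cross_distanceD(4)[OF c(1) x(2) fx(1,2)]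
        by (simp_all add: mdist_commute[of Y "f x'" "f x"])
      moreover have "2 / real (Suc n) = 1 / real (Suc n) + 1 / real (Suc n)" by simp
      ultimately show ?thesis using fx by linarith
    qed
    then have "restrict f (mspace X) \<in> K n"
      using f by (simp add: K_def)
    then show ?thesis by blast
  qed
  moreover have "closedin ?P (K n)" for n
  proof -
    have cl: "closedin ?P {f \<in> topspace ?P. \<bar>mdist Y (f x) (f x') - mdist X x x'\<bar> \<in> {..2 / real (Suc n)}}"
      if "x \<in> mspace X" "x' \<in> mspace X" for x x'
    proof (rule closedin_continuous_map_preimage)
      have "continuous_map ?P euclideanreal (\<lambda>f. mdist Y (f x) (f x'))"
        using that by (intro continuous_map_mdist continuous_map_product_projection)
      then show "continuous_map ?P euclideanreal (\<lambda>f. \<bar>mdist Y (f x) (f x') - mdist X x x'\<bar>)"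
        by (intro continuous_map_real_abs continuous_map_diff) simp_all
    qed simp
    obtain x0 where x0: "x0 \<in> mspace X" using X by (auto simp: compact_metric_def)
    have "K n = (\<Inter>(x, x') \<in> mspace X \<times> mspace X.
        {f \<in> topspace ?P. \<bar>mdist Y (f x) (f x') - mdist X x x'\<bar> \<in> {..2 / real (Suc n)}})"
      using x0 by (auto simp: K_def)
    also have "closedin ?P \<dots>"
      using x0 cl by (intro closedin_INT) auto
    finally show ?thesis .
  qed
  moreover have "decseq K"
  proof (rule decseq_SucI)
    fix n
    have "2 / real (Suc (Suc n)) \<le> 2 / real (Suc n)" by (simp add: frac_le)
    then show "K (Suc n) \<subseteq> K n"
      unfolding K_def by (blast intro: order_trans)
  qed
  moreover have "compact_space ?P"
    using Y by (simp add: compact_space_product_topology compact_metric_def)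
  ultimately have "(\<Inter>n. K n) \<noteq> {}"
    by (intro compact_space_imp_nest) auto
  then obtain f where f: "\<And>n. f \<in> K n" by blast
  have "mdist Y (f x) (f x') = mdist X x x'" if x: "x \<in> mspace X" "x' \<in> mspace X" for x x'
  proof -
    have "\<bar>mdist Y (f x) (f x') - mdist X x x'\<bar> \<le> 2 / real (Suc n)" for n
      using f[of n] x by (simp add: K_def)
    moreover have "(\<lambda>n. 2 / real (Suc n)) \<longlonglongrightarrow> 0"
      by (rule LIMSEQ_Suc[OF lim_const_over_n])
    ultimately have "\<bar>mdist Y (f x) (f x') - mdist X x x'\<bar> \<le> 0"
      by (intro LIMSEQ_le_const[of _ 0]) auto
    then show ?thesis by simp
  qed
  then have "isometric_injection X Y f"
    using f[of 0] by (auto simp: isometric_injection_def K_def)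
  then show ?thesis by blast
qed

lemma gh_distance_zero_iff:
  assumes X: "compact_metric X" and Y: "compact_metric Y"
  shows "gh_distance X Y = 0 \<longleftrightarrow> isometric X Y"
proof
  assume "isometric X Y"
  then show "gh_distance X Y = 0"
    using gh_distance_isometric[OF isometric_refl, of X Y X] gh_distance_refl[OF X] by simp
next
  assume 0: "gh_distance X Y = 0"
  then have "gh_distance Y X = 0" using gh_distance_commute[OF X Y] by simp
  then obtain f g where f: "isometric_injection X Y f" and g: "isometric_injection Y X g"
    using gh_distance_zero_injection[OF X Y 0] gh_distance_zero_injection[OF Y X] by blast
  have "(f \<circ> g) ` mspace Y = mspace Y"
    by (rule isometric_self_injection_surj[OF Y isometric_injection_comp[OF g f]])
  then have "mspace Y \<subseteq> f ` mspace X"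
    using isometric_injectionD(1)[OF g] by force
  then have "f ` mspace X = mspace Y"
    using isometric_injectionD(1)[OF f] by blast
  then show "isometric X Y" using f by (auto simp: isometric_def)
qed


section \<open>The Gromov-Hausdorff space\<close>

text \<open>By \<open>compact_metric_isometric_real\<close>, metric spaces whose points are real numbers represent all
  isometry classes of nonempty compact metric spaces.\<close>

quotient_type gh_space = "real metric" /
  partial: "\<lambda>X Y. compact_metric X \<and> compact_metric Y \<and> isometric X Y"
proof (rule part_equivpI)
  have ms: "Metric_space {0 :: real} dist"
    by (simp add: Metric_space.intro dist_commute dist_triangle)
  have "compact_metric (metric ({0 :: real}, dist))"
    using Metric_space.mspace_metric[OF ms] Metric_space.mtopology_of[OF ms]
      Metric_space.topspace_mtopology[OF ms]
    by (simp add: compact_metric_def compact_space_def finite_imp_compactin)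
  then show "\<exists>X :: real metric. compact_metric X \<and> compact_metric X \<and> isometric X X"
    using isometric_refl by blast
  show "symp (\<lambda>X Y :: real metric. compact_metric X \<and> compact_metric Y \<and> isometric X Y)"
    by (auto intro!: sympI isometric_sym)
  show "transp (\<lambda>X Y :: real metric. compact_metric X \<and> compact_metric Y \<and> isometric X Y)"
    by (auto intro!: transpI intro: isometric_trans)
qed

lift_definition gh_upper_box_dim :: "gh_space \<Rightarrow> ereal" is upper_box_dim
  by (auto simp: upper_box_dim_def dest!: covering_number_isometric)

lift_definition gh_lower_box_dim :: "gh_space \<Rightarrow> ereal" is lower_box_dim
  by (auto simp: lower_box_dim_def dest!: covering_number_isometric)

instantiation gh_space :: metric_space
begin

lift_definition dist_gh_space :: "gh_space \<Rightarrow> gh_space \<Rightarrow> real" is gh_distance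
  by (blast intro: gh_distance_isometric)

definition uniformity_gh_space :: "(gh_space \<times> gh_space) filter" where
  "uniformity_gh_space = (INF e\<in>{0<..}. principal {(x, y). dist x y < e})"

definition open_gh_space :: "gh_space set \<Rightarrow> bool" where
  "open_gh_space U \<longleftrightarrow> (\<forall>x\<in>U. eventually (\<lambda>(x', y). x' = x \<longrightarrow> y \<in> U) uniformity)"

instance
proof
  fix x y z :: gh_space
  show "dist x y = 0 \<longleftrightarrow> x = y"
    by transfer (simp add: gh_distance_zero_iff)
  show "dist x y \<le> dist x z + dist y z"
    by transfer (metis gh_distance_commute gh_distance_triangle)
qed (simp_all add: uniformity_gh_space_def open_gh_space_def)

end

end

theory Submission
  imports Defs
begin

text \<open>Covering numbers are stable under small Gromov-Hausdorff perturbations: if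
  \<open>d\<^sub>G\<^sub>H(X, Y) < r\<close> then \<open>N(Y, \<epsilon> + 2r) \<le> N(X, \<epsilon>)\<close>. Finite spaces are dense. A finite space with
  \<open>k\<close> points has covering numbers at most \<open>k\<close> at every scale, so near it the quotient
  \<open>log N(\<cdot>, \<epsilon>) / -log \<epsilon>\<close> is small at some small \<open>\<epsilon>\<close>. Replacing every point of a finite space by
  \<open>m\<close> points at mutual distance \<open>\<delta>\<close> moves it by at most \<open>\<delta>\<close>, but makes the covering number at scale
  \<open>3\<delta>/4\<close> at least \<open>m\<close>; as \<open>m\<close> may be chosen after \<open>\<delta>\<close>, the quotient is large at \<open>\<delta>/4\<close> in a
  neighbourhood of the new space.\<close>

section \<open>Covering numbers\<close>

text \<open>Compact spaces are totally bounded, and open balls lie in the closed balls of the same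
  radius. Hence the minimum defining \<open>covering_number\<close> is over a nonempty set and is
  attained.\<close>

lemma compact_metric_finite_net:
  assumes "compact_metric X" "0 < \<epsilon>"
  shows "\<exists>F. finite F \<and> F \<subseteq> mspace X \<and> mspace X \<subseteq> (\<Union>x\<in>F. mcball_of X x \<epsilon>)"
proof -
  interpret X: Metric_space "mspace X" "mdist X" by simp
  have "X.mtotally_bounded (mspace X)"
    using assms X.compact_space_eq_mcomplete_mtotally_bounded
    by (simp add: compact_metric_def mtopology_of_def)
  then obtain F where F: "finite F" "F \<subseteq> mspace X" "mspace X \<subseteq> (\<Union>x\<in>F. X.mball x \<epsilon>)"
    using assms(2) unfolding X.mtotally_bounded_def by metis
  moreover have "X.mball x \<epsilon> \<subseteq> mcball_of X x \<epsilon>" for x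
    by auto
  ultimately have "mspace X \<subseteq> (\<Union>x\<in>F. mcball_of X x \<epsilon>)"
    by blast
  then show ?thesis using F(1,2) by blast
qed

lemma covering_number_le:
  assumes "finite F" "F \<subseteq> mspace X" "mspace X \<subseteq> (\<Union>x\<in>F. mcball_of X x \<epsilon>)"
  shows "covering_number X \<epsilon> \<le> card F"
  unfolding covering_number_def using assms by (intro cInf_lower) auto

lemma covering_number_attained:
  assumes "compact_metric X" "0 < \<epsilon>"
  shows "\<exists>F. finite F \<and> F \<subseteq> mspace X \<and> mspace X \<subseteq> (\<Union>x\<in>F. mcball_of X x \<epsilon>) \<and>
    card F = covering_number X \<epsilon>"
proof -
  have "covering_number X \<epsilon> \<in> {card F | F. finite F \<and> F \<subseteq> mspace X \<and>
      mspace X \<subseteq> (\<Union>x\<in>F. mcball_of X x \<epsilon>)}"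
    unfolding covering_number_def
    using compact_metric_finite_net[OF assms] by (intro Inf_nat_def1) blast
  then show ?thesis by force
qed

text \<open>Take all points as centres. The bound does not depend on \<epsilon>.\<close>

lemma covering_number_le_card:
  assumes "finite (mspace X)" "0 < \<epsilon>"
  shows "covering_number X \<epsilon> \<le> card (mspace X)"
  using assms by (intro covering_number_le) (auto simp: mdist_self)

text \<open>Move an optimal net of \<open>X\<close> to \<open>Y\<close> by sending each centre
  \<open>p\<close> to some \<open>g p\<close> at cross distance less than \<open>r\<close>; this
  cannot increase the number of centres.\<close>

lemma covering_number_perturb:
  assumes X: "compact_metric X" and Y: "compact_metric Y"
    and r: "gh_distance X Y < r" and "0 < \<epsilon>"
  shows "covering_number Y (\<epsilon> + 2 * r) \<le> covering_number X \<epsilon>"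
proof -
  obtain c where c: "cross_distance X Y c" "cross_within X Y c r"
    using gh_distance_less_cross[OF X Y r] by blast
  obtain F where F: "finite F" "F \<subseteq> mspace X" "mspace X \<subseteq> (\<Union>x\<in>F. mcball_of X x \<epsilon>)"
      "card F = covering_number X \<epsilon>"
    using covering_number_attained[OF X \<open>0 < \<epsilon>\<close>] by blast
  obtain g where g: "\<And>x. x \<in> mspace X \<Longrightarrow> g x \<in> mspace Y \<and> c x (g x) < r"
    using c(2) unfolding cross_within_def by metis
  have "covering_number Y (\<epsilon> + 2 * r) \<le> card (g ` F)"
  proof (rule covering_number_le)
    show "mspace Y \<subseteq> (\<Union>y\<in>g ` F. mcball_of Y y (\<epsilon> + 2 * r))"
    proof
      fix y assume y: "y \<in> mspace Y"
      then obtain x where x: "x \<in> mspace X" "c x y < r"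
        using c(2) unfolding cross_within_def by blast
      then obtain p where p: "p \<in> F" "x \<in> mcball_of X p \<epsilon>" using F(3) by auto
      then have "p \<in> mspace X" "mdist X p x \<le> \<epsilon>" using F(2) by auto
      \<comment> \<open>The route from \<open>g p\<close> through \<open>p\<close> and
        \<open>x\<close> to \<open>y\<close> has legs bounded by \<open>r\<close>, \<epsilon> and
        \<open>r\<close>.\<close>
      then have "mdist Y (g p) y \<le> \<epsilon> + 2 * r"
        using cross_distanceD(5)[OF c(1) _ _ y, of p "g p"] cross_distanceD(2)[OF c(1) _ x(1) y, of p]
          g[of p] x by linarith
      then show "y \<in> (\<Union>y\<in>g ` F. mcball_of Y y (\<epsilon> + 2 * r))"
        using p y g \<open>p \<in> mspace X\<close> by auto
    qed
  qed (use F g in auto)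
  also have "\<dots> \<le> covering_number X \<epsilon>"
    using card_image_le[OF F(1), of g] F(4) by simp
  finally show ?thesis .
qed


section \<open>Finite approximations\<close>

lemma finite_compact_metric:
  assumes "finite (mspace X)" "mspace X \<noteq> {}"
  shows "compact_metric X"
  using assms by (auto simp: compact_metric_def compact_space_def intro: finite_imp_compactin)

text \<open>A finite \<delta>-net with the induced metric does it, with \<open>X\<close> itself as
  the ambient space.\<close>

lemma finite_metric_approx:
  fixes X :: "'a metric"
  assumes X: "compact_metric X" and "0 < \<delta>"
  shows "\<exists>Y :: 'a metric. compact_metric Y \<and> finite (mspace Y) \<and> gh_distance X Y \<le> \<delta>"
proof -
  obtain F where F: "finite F" "F \<subseteq> mspace X" "mspace X \<subseteq> (\<Union>x\<in>F. mcball_of X x \<delta>)"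
    using compact_metric_finite_net[OF assms] by blast
  define Y where "Y = submetric X F"
  have mY: "mspace Y = F" "mdist Y = mdist X"
    using F(2) by (auto simp: Y_def)
  have ne: "mspace X \<noteq> {}" "F \<noteq> {}"
    using X F(3) by (auto simp: compact_metric_def)
  have Y: "compact_metric Y"
    using F(1) ne by (intro finite_compact_metric) (simp_all add: mY)
  have inj: "isometric_injection X X id" "isometric_injection Y X id"
    using F(2) by (auto simp: isometric_injection_def mY)
  have "hausdorff_distance X (id ` mspace X) (id ` mspace Y) \<le> \<delta>"
  proof (rule hausdorff_distance_le)
    fix a assume "a \<in> id ` mspace X"
    then show "\<exists>b\<in>id ` mspace Y. mdist X a b \<le> \<delta>"
      using F(3) by (force simp: mY mdist_commute)
  next
    fix b assume "b \<in> id ` mspace Y"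
    then show "\<exists>a\<in>id ` mspace X. mdist X a b \<le> \<delta>"
      using F(2) \<open>0 < \<delta>\<close> by (intro bexI[of _ b]) (auto simp: mY mdist_self subset_iff)
  qed (use ne in \<open>auto simp: mY\<close>)
  then have "gh_distance X Y \<le> \<delta>"
    using gh_distance_le_hausdorff[OF X Y inj] by linarith
  then show ?thesis using Y F(1) mY by auto
qed

text \<open>\<open>Y\<close> is the product of \<open>X\<close> with \<open>m\<close> points at
  mutual distance \<delta>, under the sum metric: \<open>m\<close> parallel sheets, each a copy of
  \<open>X\<close>. A ball of radius below \<delta> stays within one sheet, so a cover needs a
  centre in every sheet.\<close>

lemma finite_metric_blowup:
  fixes X :: "'a metric"
  assumes X: "compact_metric X" and fin: "finite (mspace X)" and "0 < \<delta>" and "0 < m"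
  shows "\<exists>Y :: ('a \<times> nat) metric. compact_metric Y \<and> gh_distance X Y \<le> \<delta> \<and>
    (\<forall>\<epsilon>. 0 < \<epsilon> \<and> \<epsilon> < \<delta> \<longrightarrow> m \<le> covering_number Y \<epsilon>)"
proof -
  define d :: "'a \<times> nat \<Rightarrow> 'a \<times> nat \<Rightarrow> real"
    where "d = (\<lambda>(x, i) (y, j). mdist X x y + (if i = j then 0 else \<delta>))"
  let ?M = "mspace X \<times> {..<m}"
  interpret D: Metric_space ?M d
  proof
    fix u v w
    show "0 \<le> d u v" "d u v = d v u"
      using \<open>0 < \<delta>\<close> by (auto simp: d_def mdist_commute split: prod.splits)
    assume uv: "u \<in> ?M" "v \<in> ?M"
    show "d u v = 0 \<longleftrightarrow> u = v"
    proof
      assume "d u v = 0"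
      then show "u = v"
        using uv \<open>0 < \<delta>\<close> add_nonneg_pos[of "mdist X (fst u) (fst v)" \<delta>]
        by (auto simp: d_def split: prod.splits if_splits)
    qed (use uv in \<open>auto simp: d_def\<close>)
    assume "w \<in> ?M"
    then show "d u w \<le> d u v + d v w"
      using uv \<open>0 < \<delta>\<close> mdist_triangle[of "fst u" X "fst v" "fst w"]
      by (auto simp: d_def split: prod.splits)
  qed
  define Y where "Y = metric (?M, d)"
  have mY: "mspace Y = ?M" "mdist Y = d" unfolding Y_def by simp_all
  have Y: "compact_metric Y"
    using fin X \<open>0 < m\<close> by (intro finite_compact_metric) (auto simp: mY compact_metric_def)
  \<comment> \<open>\<open>Y\<close> is its own ambient space, and \<open>X\<close> sits in it as
    sheet 0.\<close>
  have inj: "isometric_injection X Y (\<lambda>x. (x, 0))" "isometric_injection Y Y id"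
    using \<open>0 < m\<close> by (auto simp: isometric_injection_def mY d_def)
  have "hausdorff_distance Y ((\<lambda>x. (x, 0)) ` mspace X) (id ` mspace Y) \<le> \<delta>"
  proof (rule hausdorff_distance_le)
    fix a assume "a \<in> (\<lambda>x. (x, 0::nat)) ` mspace X"
    then show "\<exists>b\<in>id ` mspace Y. mdist Y a b \<le> \<delta>"
      using \<open>0 < m\<close> \<open>0 < \<delta>\<close> by (intro bexI[of _ a]) (auto simp: mY d_def mdist_self)
  next
    fix b assume "b \<in> id ` mspace Y"
    then show "\<exists>a\<in>(\<lambda>x. (x, 0)) ` mspace X. mdist Y a b \<le> \<delta>"
      using \<open>0 < \<delta>\<close> by (intro bexI[of _ "(fst b, 0)"]) (auto simp: mY d_def mdist_self)
  qed (use X \<open>0 < m\<close> in \<open>auto simp: mY compact_metric_def\<close>)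
  then have "gh_distance X Y \<le> \<delta>"
    using gh_distance_le_hausdorff[OF X Y inj] by linarith
  moreover have "m \<le> covering_number Y \<epsilon>" if \<epsilon>: "0 < \<epsilon>" "\<epsilon> < \<delta>" for \<epsilon>
  proof -
    obtain F where F: "finite F" "F \<subseteq> mspace Y" "mspace Y \<subseteq> (\<Union>x\<in>F. mcball_of Y x \<epsilon>)"
        "card F = covering_number Y \<epsilon>"
      using covering_number_attained[OF Y \<epsilon>(1)] by blast
    obtain x0 where x0: "x0 \<in> mspace X" using X by (auto simp: compact_metric_def)
    \<comment> \<open>Covering the fibre over the single point \<open>x0\<close> already forces
      every sheet index to occur among the centres.\<close>
    have "{..<m} \<subseteq> snd ` F"
    proof
      fix i assume "i \<in> {..<m}"
      then have "(x0, i) \<in> mspace Y" using x0 by (simp add: mY)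
      then obtain x j where p: "(x, j) \<in> F" "(x0, i) \<in> mcball_of Y (x, j) \<epsilon>"
        using F(3) by fastforce
      then have "d (x, j) (x0, i) < \<delta>" using \<epsilon>(2) by (simp add: mY)
      then have "j = i"
        using mdist_nonneg[of X x x0] by (auto simp: d_def split: if_splits simp del: mdist_nonneg)
      then show "i \<in> snd ` F" using p(1) by force
    qed
    then have "card {..<m} \<le> card F"
      using F(1) by (rule surj_card_le[rotated])
    then show ?thesis using F(4) by simp
  qed
  ultimately show ?thesis using Y by blast
qed


section \<open>Dense open sets in the Gromov-Hausdorff space\<close>

text \<open>With covering numbers defined on isometry classes, the category argument can run in
  \<open>gh_space\<close> without representatives.\<close>

lift_definition gh_covering_number :: "gh_space \<Rightarrow> real \<Rightarrow> nat" is covering_number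
  by (auto dest: covering_number_isometric)

lemma gh_lower_box_dim_eq:
  "gh_lower_box_dim X =
     Liminf (at_right 0) (\<lambda>\<epsilon>. ereal (ln (real (gh_covering_number X \<epsilon>)) / - ln \<epsilon>))"
  by transfer (simp add: lower_box_dim_def)

lemma gh_upper_box_dim_eq:
  "gh_upper_box_dim X =
     Limsup (at_right 0) (\<lambda>\<epsilon>. ereal (ln (real (gh_covering_number X \<epsilon>)) / - ln \<epsilon>))"
  by transfer (simp add: upper_box_dim_def)

text \<open>\<open>Y\<close> is a finite approximation and \<open>k\<close> its number of points.
  The order of quantifiers matters: \<open>k\<close> is fixed before \<epsilon>, so a scale can
  later be chosen in terms of \<open>k\<close>.\<close>

lemma gh_covering_number_small_nearby:
  assumes "0 < e"
  shows "\<exists>Y. dist X Y < e \<and> (\<exists>k. \<forall>\<epsilon>>0. \<forall>Z. dist Y Z < \<epsilon> / 4 \<longrightarrow> gh_covering_number Z \<epsilon> \<le> k)"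
  using assms
proof (transfer fixing: e)
  fix X :: "real metric"
  assume "compact_metric X \<and> compact_metric X \<and> isometric X X"
  then obtain Y :: "real metric" where Y: "compact_metric Y" "finite (mspace Y)"
      "gh_distance X Y \<le> e / 2"
    using finite_metric_approx[of X "e / 2"] \<open>0 < e\<close> by auto
  \<comment> \<open>Perturbing by \<epsilon>/4 enlarges the scale \<epsilon>/2 at \<open>Y\<close>
    to exactly \<epsilon> at \<open>Z\<close>.\<close>
  have "covering_number Z \<epsilon> \<le> card (mspace Y)"
    if "0 < \<epsilon>" "compact_metric Z" "gh_distance Y Z < \<epsilon> / 4" for \<epsilon> and Z :: "real metric"
    using covering_number_perturb[OF Y(1) that(2,3), of "\<epsilon> / 2"]
      covering_number_le_card[OF Y(2), of "\<epsilon> / 2"] that(1) by simp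
  then show "\<exists>Y\<in>{Y :: real metric. compact_metric Y \<and> compact_metric Y \<and> isometric Y Y}.
      gh_distance X Y < e \<and> (\<exists>k. \<forall>\<epsilon>>0. \<forall>Z\<in>{Z :: real metric. compact_metric Z \<and> compact_metric Z \<and> isometric Z Z}.
        gh_distance Y Z < \<epsilon> / 4 \<longrightarrow> covering_number Z \<epsilon> \<le> k)"
    using Y \<open>0 < e\<close> isometric_refl by (intro bexI[of _ Y]) auto
qed

text \<open>Approximate by a finite space, then blow it up; each move costs at most \<delta>. The
  number \<open>m\<close> is independent of \<delta>.\<close>

lemma gh_covering_number_large_nearby:
  assumes "0 < \<delta>" "0 < m"
  shows "\<exists>Y. dist X Y \<le> 2 * \<delta> \<and>
    (\<forall>Z. dist Y Z < \<delta> / 4 \<longrightarrow> m \<le> gh_covering_number Z (\<delta> / 4))"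
  using assms
proof (transfer fixing: \<delta> m)
  fix X :: "real metric"
  assume "compact_metric X \<and> compact_metric X \<and> isometric X X"
  then have X: "compact_metric X" by simp
  obtain W :: "real metric" where W: "compact_metric W" "finite (mspace W)" "gh_distance X W \<le> \<delta>"
    using finite_metric_approx[OF X \<open>0 < \<delta>\<close>] by blast
  obtain V :: "(real \<times> nat) metric" where V: "compact_metric V" "gh_distance W V \<le> \<delta>"
      "\<And>\<epsilon>. 0 < \<epsilon> \<Longrightarrow> \<epsilon> < \<delta> \<Longrightarrow> m \<le> covering_number V \<epsilon>"
    using finite_metric_blowup[OF W(1,2) assms] by blast
  \<comment> \<open>The blow-up has points in \<open>real \<times> nat\<close>, so it is copied to a
    space of reals, as elements of \<open>gh_space\<close> require.\<close>
  obtain Y :: "real metric" where Y: "compact_metric Y" "isometric V Y"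
    using compact_metric_isometric_real[OF V(1)] by blast
  have "gh_distance X Y \<le> 2 * \<delta>"
    using gh_distance_triangle[OF X W(1) V(1)] W(3) V(2)
      gh_distance_isometric[OF isometric_refl Y(2), of X] by linarith
  moreover have "m \<le> covering_number Z (\<delta> / 4)"
    if Z: "compact_metric Z" "gh_distance Y Z < \<delta> / 4" for Z :: "real metric"
  proof -
    \<comment> \<open>Passing from \<open>Z\<close> back to \<open>Y\<close> turns the scale
      \<delta>/4 into 3\<delta>/4, still below the separation \<delta> of the sheets.\<close>
    have "m \<le> covering_number Y (\<delta> / 4 + 2 * (\<delta> / 4))"
      using V(3)[of "\<delta> / 4 + 2 * (\<delta> / 4)"] covering_number_isometric[OF Y(2)] \<open>0 < \<delta>\<close> by simp
    also have "\<dots> \<le> covering_number Z (\<delta> / 4)"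
      using covering_number_perturb[OF Z(1) Y(1), of "\<delta> / 4" "\<delta> / 4"] Z(2) \<open>0 < \<delta>\<close>
        gh_distance_commute[OF Y(1) Z(1)] by simp
    finally show ?thesis .
  qed
  ultimately show "\<exists>Y\<in>{Y :: real metric. compact_metric Y \<and> compact_metric Y \<and> isometric Y Y}.
      gh_distance X Y \<le> 2 * \<delta> \<and> (\<forall>Z\<in>{Z :: real metric. compact_metric Z \<and> compact_metric Z \<and> isometric Z Z}.
        gh_distance Y Z < \<delta> / 4 \<longrightarrow> m \<le> covering_number Z (\<delta> / 4))"
    using Y(1) isometric_refl by (intro bexI[of _ Y]) auto
qed

section \<open>Rare complements and residual sets\<close>

text \<open>The hypothesis says that \<open>G\<close> has dense interior. A ball inside the closure
  of \<open>- G\<close> would contain the centre of a ball contained in \<open>G\<close>, which is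
  impossible.\<close>

lemma rare_ComplI:
  fixes G :: "'a::metric_space set"
  assumes "\<And>x e. 0 < e \<Longrightarrow> \<exists>y r. 0 < r \<and> dist x y < e \<and> (\<forall>z. dist y z < r \<longrightarrow> z \<in> G)"
  shows "rare (- G)"
proof -
  have "x \<notin> interior (closure (- G))" for x
  proof
    assume "x \<in> interior (closure (- G))"
    then obtain e where e: "0 < e" "ball x e \<subseteq> closure (- G)" by (auto simp: mem_interior)
    obtain y r where y: "0 < r" "dist x y < e" "\<forall>z. dist y z < r \<longrightarrow> z \<in> G"
      using assms[OF e(1)] by blast
    then have "y \<in> closure (- G)" using e(2) by auto
    then obtain z where "z \<in> - G" "dist z y < r" using y(1) closure_approachable by blast
    then show False using y(3) by (simp add: dist_commute)
  qed
  then show ?thesis by (auto simp: rare_def)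
qed

lemma rare_subset: "rare T \<Longrightarrow> S \<subseteq> T \<Longrightarrow> rare S"
  unfolding rare_def by (metis closure_mono interior_mono subset_empty)

lemma residualI:
  fixes A :: "nat \<Rightarrow> 'a::topological_space set"
  assumes "\<And>n. rare (- A n)" "(\<Inter>n. A n) \<subseteq> S"
  shows "residual S"
  unfolding residual_def meager_def
proof (intro exI conjI ballI)
  \<comment> \<open>\<open>meager\<close> asks for an exact union, so the sets \<open>- A n\<close>
    are cut down to \<open>- S\<close>.\<close>
  let ?\<A> = "range (\<lambda>n. - A n \<inter> - S)"
  show "countable ?\<A>" by simp
  show "- S = \<Union>?\<A>" using assms(2) by blast
  fix B assume "B \<in> ?\<A>"
  then obtain n where "B \<subseteq> - A n" by blast
  then show "rare B" by (rule rare_subset[OF assms(1)])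
qed

text \<open>Near a finite space the numerator is bounded by a constant while the denominator grows
  without bound as the scale shrinks.\<close>

lemma rare_lower_quotient_large:
  assumes "0 < t"
  shows "rare (- {X. \<exists>\<epsilon>. 0 < \<epsilon> \<and> \<epsilon> < t \<and> ln (real (gh_covering_number X \<epsilon>)) / - ln \<epsilon> \<le> t})"
proof (rule rare_ComplI)
  fix X :: gh_space and e :: real assume "0 < e"
  then obtain Y k where Y: "dist X Y < e"
      and k: "\<And>\<epsilon> Z. 0 < \<epsilon> \<Longrightarrow> dist Y Z < \<epsilon> / 4 \<Longrightarrow> gh_covering_number Z \<epsilon> \<le> k"
    using gh_covering_number_small_nearby by metis
  \<comment> \<open>The second bound makes \<open>- ln \<epsilon>\<close> exceed
    \<open>ln (Suc k) / t\<close>; the summand \<open>- 1\<close> makes this strict, hence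
    \<open>- ln \<epsilon>\<close> positive even for \<open>k = 0\<close>.\<close>
  define \<epsilon> where "\<epsilon> = min (t / 2) (exp (- (ln (real (Suc k)) / t) - 1))"
  have \<epsilon>: "0 < \<epsilon>" "\<epsilon> < t" using assms by (auto simp: \<epsilon>_def)
  have "\<epsilon> \<le> exp (- (ln (real (Suc k)) / t) - 1)" by (simp add: \<epsilon>_def)
  then have "ln \<epsilon> \<le> - (ln (real (Suc k)) / t) - 1"
    using \<epsilon>(1) ln_mono ln_exp by metis
  then have l: "ln (real (Suc k)) / t < - ln \<epsilon>" by linarith
  moreover have "0 \<le> ln (real (Suc k)) / t" using assms by simp
  ultimately have pos: "0 < - ln \<epsilon>" by linarith
  have "ln (real (gh_covering_number Z \<epsilon>)) / - ln \<epsilon> \<le> t" if "dist Y Z < \<epsilon> / 4" for Z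
  proof -
    \<comment> \<open>A covering number 0 is dealt with by the default value
      \<open>ln 0 = 0\<close>.\<close>
    have "ln (real (gh_covering_number Z \<epsilon>)) \<le> ln (real (Suc k))"
      using k[OF \<epsilon>(1) that] by (cases "gh_covering_number Z \<epsilon> = 0") simp_all
    also have "\<dots> \<le> t * - ln \<epsilon>"
      using l assms by (simp add: field_simps)
    finally show ?thesis using pos by (simp only: pos_divide_le_eq)
  qed
  then have "Z \<in> {X. \<exists>\<epsilon>. 0 < \<epsilon> \<and> \<epsilon> < t \<and> ln (real (gh_covering_number X \<epsilon>)) / - ln \<epsilon> \<le> t}"
    if "dist Y Z < \<epsilon> / 4" for Z
    using that \<epsilon> by blast
  moreover have "0 < \<epsilon> / 4" "dist X Y < e" using Y \<epsilon> by simp_all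
  ultimately show "\<exists>Y r. 0 < r \<and> dist X Y < e \<and> (\<forall>Z. dist Y Z < r \<longrightarrow>
      Z \<in> {X. \<exists>\<epsilon>. 0 < \<epsilon> \<and> \<epsilon> < t \<and> ln (real (gh_covering_number X \<epsilon>)) / - ln \<epsilon> \<le> t})"
    by blast
qed

lemma rare_upper_quotient_small:
  assumes "0 < t"
  shows "rare (- {X. \<exists>\<epsilon>. 0 < \<epsilon> \<and> \<epsilon> < t \<and> c \<le> ln (real (gh_covering_number X \<epsilon>)) / - ln \<epsilon>})"
proof (rule rare_ComplI)
  fix X :: gh_space and e :: real assume "0 < e"
  \<comment> \<open>The three bounds give, in turn, \<open>2 * \<delta> < e\<close>, a scale
    \<delta>/4 below \<open>t\<close>, and a positive denominator.\<close>
  define \<delta> where "\<delta> = min (e / 4) (min t 1)"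
  have \<delta>: "0 < \<delta>" "2 * \<delta> < e" "\<delta> / 4 < t" "\<delta> / 4 < 1"
    using assms \<open>0 < e\<close> by (auto simp: \<delta>_def)
  then have pos: "0 < - ln (\<delta> / 4)" by simp
  \<comment> \<open>Only now, with \<delta> fixed, is \<open>m\<close> chosen, so that
    \<open>ln m\<close> beats \<open>c\<close> times the denominator.\<close>
  obtain m where m: "exp (c * - ln (\<delta> / 4)) < real m"
    using reals_Archimedean2 by blast
  then have "0 < real m" using exp_gt_zero order_less_trans by blast
  then have "0 < m" by simp
  then obtain Y where Y: "dist X Y \<le> 2 * \<delta>"
      and large: "\<And>Z. dist Y Z < \<delta> / 4 \<Longrightarrow> m \<le> gh_covering_number Z (\<delta> / 4)"
    using gh_covering_number_large_nearby[OF \<delta>(1)] by blast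
  have "c \<le> ln (real (gh_covering_number Z (\<delta> / 4))) / - ln (\<delta> / 4)"
    if "dist Y Z < \<delta> / 4" for Z
  proof -
    have le: "real m \<le> real (gh_covering_number Z (\<delta> / 4))" using large[OF that] by simp
    have "c * - ln (\<delta> / 4) \<le> ln (real (gh_covering_number Z (\<delta> / 4)))"
      using m le \<open>0 < real m\<close> by (subst ln_ge_iff) linarith+
    then show ?thesis using pos by (simp only: pos_le_divide_eq)
  qed
  then have "Z \<in> {X. \<exists>\<epsilon>. 0 < \<epsilon> \<and> \<epsilon> < t \<and> c \<le> ln (real (gh_covering_number X \<epsilon>)) / - ln \<epsilon>}"
    if "dist Y Z < \<delta> / 4" for Z
    using that \<delta> by (intro CollectI exI[of _ "\<delta> / 4"] conjI) (simp_all only: zero_less_divide_iff zero_less_numeral simp_thms)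
  moreover have "0 < \<delta> / 4" "dist X Y < e" using Y \<delta> by simp_all
  ultimately show "\<exists>Y r. 0 < r \<and> dist X Y < e \<and> (\<forall>Z. dist Y Z < r \<longrightarrow>
      Z \<in> {X. \<exists>\<epsilon>. 0 < \<epsilon> \<and> \<epsilon> < t \<and> c \<le> ln (real (gh_covering_number X \<epsilon>)) / - ln \<epsilon>})"
    by blast
qed


section \<open>Limits along the scale\<close>

text \<open>Reduces behaviour as the scale tends to 0 to countably many thresholds, matching the
  countable intersections of the category argument.\<close>

lemma eventually_at_right_0_inverse_Suc:
  fixes P :: "real \<Rightarrow> bool"
  assumes "eventually P (at_right 0)"
  shows "\<exists>n0. \<forall>n\<ge>n0. \<forall>\<epsilon>. 0 < \<epsilon> \<and> \<epsilon> < inverse (real (Suc n)) \<longrightarrow> P \<epsilon>"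
proof -
  obtain b where b: "0 < b" "\<And>\<epsilon>. 0 < \<epsilon> \<Longrightarrow> \<epsilon> < b \<Longrightarrow> P \<epsilon>"
    using assms unfolding eventually_at_right_field by auto
  obtain n0 where n0: "inverse (real (Suc n0)) < b"
    using reals_Archimedean[OF b(1)] by blast
  have "inverse (real (Suc n)) < b" if "n0 \<le> n" for n
    using that n0 by (intro order_le_less_trans[OF _ n0] le_imp_inverse_le) simp_all
  then show ?thesis using b(2) by (meson order_less_trans)
qed

lemma Liminf_at_right_0_eq_0:
  fixes f :: "real \<Rightarrow> real"
  assumes nonneg: "\<And>\<epsilon>. 0 < \<epsilon> \<Longrightarrow> \<epsilon> < 1 \<Longrightarrow> 0 \<le> f \<epsilon>"
    and small: "\<And>n. \<exists>\<epsilon>. 0 < \<epsilon> \<and> \<epsilon> < inverse (real (Suc n)) \<and> f \<epsilon> \<le> inverse (real (Suc n))"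
  shows "Liminf (at_right 0) (\<lambda>\<epsilon>. ereal (f \<epsilon>)) = 0"
proof (rule antisym)
  have "eventually (\<lambda>\<epsilon>. 0 < \<epsilon> \<and> \<epsilon> < (1::real)) (at_right 0)"
    by (auto simp: eventually_at_right_field intro!: exI[of _ 1])
  then show "0 \<le> Liminf (at_right 0) (\<lambda>\<epsilon>. ereal (f \<epsilon>))"
    by (intro Liminf_bounded) (auto elim!: eventually_mono intro: nonneg)
  show "Liminf (at_right 0) (\<lambda>\<epsilon>. ereal (f \<epsilon>)) \<le> 0"
  proof (rule ccontr)
    assume "\<not> ?thesis"
    then obtain c where c: "0 < ereal c" "ereal c < Liminf (at_right 0) (\<lambda>\<epsilon>. ereal (f \<epsilon>))"
      by (metis ereal_dense2 not_le)
    then have "eventually (\<lambda>\<epsilon>. c < f \<epsilon>) (at_right 0)"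
      by (auto dest: less_LiminfD)
    then obtain n0 where n0: "\<And>n \<epsilon>. n0 \<le> n \<Longrightarrow> 0 < \<epsilon> \<Longrightarrow> \<epsilon> < inverse (real (Suc n)) \<Longrightarrow> c < f \<epsilon>"
      using eventually_at_right_0_inverse_Suc by metis
    obtain n1 where n1: "inverse (real (Suc n1)) < c"
      using reals_Archimedean c(1) by auto
    \<comment> \<open>The index is at least \<open>n0\<close>, which forces
      \<open>c < f \<epsilon>\<close>, and at least \<open>n1\<close>, which forces
      \<open>f \<epsilon> < c\<close>.\<close>
    obtain \<epsilon> where \<epsilon>: "0 < \<epsilon>" "\<epsilon> < inverse (real (Suc (n0 + n1)))"
        "f \<epsilon> \<le> inverse (real (Suc (n0 + n1)))"
      using small by blast
    have "c < f \<epsilon>" using n0[OF _ \<epsilon>(1,2)] by simp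
    moreover have "inverse (real (Suc (n0 + n1))) \<le> inverse (real (Suc n1))"
      by (intro le_imp_inverse_le) simp_all
    ultimately show False using \<epsilon>(3) n1 by linarith
  qed
qed

lemma Limsup_at_right_0_eq_infinity:
  fixes f :: "real \<Rightarrow> real"
  assumes "\<And>n. \<exists>\<epsilon>. 0 < \<epsilon> \<and> \<epsilon> < inverse (real (Suc n)) \<and> real n \<le> f \<epsilon>"
  shows "Limsup (at_right 0) (\<lambda>\<epsilon>. ereal (f \<epsilon>)) = \<infinity>"
proof (rule ccontr)
  assume "\<not> ?thesis"
  then obtain c where "Limsup (at_right 0) (\<lambda>\<epsilon>. ereal (f \<epsilon>)) < ereal c"
    using ereal_dense2 by (metis ereal_infty_less(1))
  then have "eventually (\<lambda>\<epsilon>. f \<epsilon> < c) (at_right 0)"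
    by (auto dest: Limsup_lessD)
  then obtain n0 where n0: "\<And>n \<epsilon>. n0 \<le> n \<Longrightarrow> 0 < \<epsilon> \<Longrightarrow> \<epsilon> < inverse (real (Suc n)) \<Longrightarrow> f \<epsilon> < c"
    using eventually_at_right_0_inverse_Suc by metis
  obtain n1 where n1: "c < real n1" using reals_Archimedean2 by blast
  \<comment> \<open>Again one index beyond both thresholds: \<open>n0\<close> gives
    \<open>f \<epsilon> < c\<close>, and \<open>n1\<close> gives
    \<open>c < f \<epsilon>\<close>.\<close>
  obtain \<epsilon> where \<epsilon>: "0 < \<epsilon>" "\<epsilon> < inverse (real (Suc (n0 + n1)))" "real (n0 + n1) \<le> f \<epsilon>"
    using assms by blast
  then show False using n0[OF _ \<epsilon>(1,2)] n1 by simp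
qed

theorem theorem7:
  shows "residual {X :: gh_space. gh_lower_box_dim X = 0 \<and> gh_upper_box_dim X = \<infinity>}"
proof -
  let ?q = "\<lambda>X \<epsilon>. ln (real (gh_covering_number X \<epsilon>)) / - ln \<epsilon>"
  let ?t = "\<lambda>n. inverse (real (Suc n))"
  define L where "L n = {X. \<exists>\<epsilon>. 0 < \<epsilon> \<and> \<epsilon> < ?t n \<and> ?q X \<epsilon> \<le> ?t n}" for n
  define U where "U n = {X. \<exists>\<epsilon>. 0 < \<epsilon> \<and> \<epsilon> < ?t n \<and> real n \<le> ?q X \<epsilon>}" for n
  \<comment> \<open>Both families are interleaved into one sequence: index \<open>2 * n\<close>
    gives \<open>L n\<close> and \<open>2 * n + 1\<close> gives \<open>U n\<close>.\<close>
  define A where "A n = (if even n then L (n div 2) else U (n div 2))" for n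
  have "rare (- A n)" for n
    unfolding A_def L_def U_def
    by (simp only: if_distrib[of uminus] if_distrib[of rare] rare_lower_quotient_large
        rare_upper_quotient_small positive_imp_inverse_positive of_nat_0_less_iff zero_less_Suc if_cancel)
  moreover have "gh_lower_box_dim X = 0 \<and> gh_upper_box_dim X = \<infinity>" if "X \<in> (\<Inter>n. A n)" for X
  proof
    have X: "X \<in> A n" for n using that by blast
    have "X \<in> L n" "X \<in> U n" for n
      using X[of "2 * n"] X[of "2 * n + 1"] by (simp_all add: A_def)
    then have "\<exists>\<epsilon>. 0 < \<epsilon> \<and> \<epsilon> < ?t n \<and> ?q X \<epsilon> \<le> ?t n"
        "\<exists>\<epsilon>. 0 < \<epsilon> \<and> \<epsilon> < ?t n \<and> real n \<le> ?q X \<epsilon>" for n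
      unfolding L_def U_def by blast+
    \<comment> \<open>Below scale 1 the denominator is positive; the numerator is nonnegative for
      every natural covering number, again with \<open>ln 0 = 0\<close>.\<close>
    moreover have "0 \<le> ?q X \<epsilon>" if "0 < \<epsilon>" "\<epsilon> < 1" for \<epsilon>
      using that by (cases "gh_covering_number X \<epsilon> = 0") (simp_all add: divide_le_0_iff ln_le_zero_iff)
    ultimately show "gh_lower_box_dim X = 0" "gh_upper_box_dim X = \<infinity>"
      unfolding gh_lower_box_dim_eq gh_upper_box_dim_eq
      by (intro Liminf_at_right_0_eq_0 Limsup_at_right_0_eq_infinity; blast)+
  qed
  ultimately show ?thesis
    by (intro residualI[of A]) blast+
qed

end
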